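(* The theories $\mathrm{INF}_{\mathsf{Set}}$ and $\mathrm{INFU}_{\mathsf{Set}}+(|V|=|\mathcal{P}(V)|)$ are equiconsistent, and the theories $\mathrm{NF}_{\mathsf{Set}}$ and $\mathrm{NFU}_{\mathsf{Set}}+(|V|=|\mathcal{P}(V)|)$ are equiconsistent.
   Context: $\mathcal{L}_{\mathsf{Set}}=\{\in,S,\langle-,-\rangle\}$, with $S$ a unary predicate (sethood) and $\langle-,-\rangle$ a binary function symbol (ordered pair). A formula $\phi$ is stratified if there is $s$ assigning a natural number to each term occurring in $\phi$ with $s(\langle v,w\rangle)=s(v)=s(w)$; $s(u)=s(v)$ for each atomic subformula $u=v$; $s(u)+1=s(v)$ for each atomic subformula $u\in v$. $\mathrm{NFU}_{\mathsf{Set}}$ (in classical logic) and $\mathrm{INFU}_{\mathsf{Set}}$ (in intuitionistic logic) have as axioms the universal closures of: $(S(x)\wedge S(y)\wedge\forall z(z\in x\leftrightarrow z\in y))\to x=y$; $\exists x(S(x)\wedge\forall z(z\in x\leftrightarrow\phi(z)))$ for each stratified $\phi$ in which $x$ is not free; $\langle x,y\rangle=\langle x',y'\rangle\to(x=x'\wedge y=y')$; $z\in x\to S(x)$. $\mathrm{NF}_{\mathsf{Set}}$ and $\mathrm{INF}_{\mathsf{Set}}$ are obtained by adding $\forall x\,S(x)$. In these theories $V=\{x\mid x=x\}$ is the universal set, $\mathcal{P}(V)=\{x\mid S(x)\}$ is the set of all sets, and $|V|=|\mathcal{P}(V)|$ states that there is a bijection (a set of ordered pairs) between $V$ and $\mathcal{P}(V)$.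 *)

theory Defs
  imports Main
begin

section \<open>The language\<close>

text \<open>
  Variables are de Bruijn indices, so formulas are identified up to renaming of bound variables:
  under \<open>n\<close> quantifiers, \<open>Var i\<close> with \<open>i < n\<close> is bound and \<open>Var (n + j)\<close> is the free variable \<open>j\<close>.
\<close>

datatype tm =
    Var nat
  | OPair tm tm

datatype fm =
    Bot
  | Eq tm tm      (infix "\<^bold>=" 55)
  | Mem tm tm     (infix "\<^bold>\<in>" 55)
  | SetP tm
  | And fm fm     (infixr "\<^bold>\<and>" 45)
  | Or fm fm      (infixr "\<^bold>\<or>" 40)
  | Imp fm fm     (infixr "\<^bold>\<longrightarrow>" 35)
  | All fm
  | Ex fm

abbreviation Neg :: "fm \<Rightarrow> fm" where
  "Neg p \<equiv> p \<^bold>\<longrightarrow> Bot"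

abbreviation Iff :: "fm \<Rightarrow> fm \<Rightarrow> fm"  (infix "\<^bold>\<longleftrightarrow>" 35) where
  "p \<^bold>\<longleftrightarrow> q \<equiv> (p \<^bold>\<longrightarrow> q) \<^bold>\<and> (q \<^bold>\<longrightarrow> p)"

primrec fv_tm :: "tm \<Rightarrow> nat set" where
  "fv_tm (Var i) = {i}"
| "fv_tm (OPair t u) = fv_tm t \<union> fv_tm u"

primrec fv :: "fm \<Rightarrow> nat set" where
  "fv Bot = {}"
| "fv (t \<^bold>= u) = fv_tm t \<union> fv_tm u"
| "fv (t \<^bold>\<in> u) = fv_tm t \<union> fv_tm u"
| "fv (SetP t) = fv_tm t"
| "fv (p \<^bold>\<and> q) = fv p \<union> fv q"
| "fv (p \<^bold>\<or> q) = fv p \<union> fv q"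
| "fv (p \<^bold>\<longrightarrow> q) = fv p \<union> fv q"
| "fv (All p) = {i. Suc i \<in> fv p}"
| "fv (Ex p) = {i. Suc i \<in> fv p}"

definition univ_closure :: "fm \<Rightarrow> fm" where
  "univ_closure p = (All ^^ (LEAST n. fv p \<subseteq> {..<n})) p"

primrec subst_tm :: "(nat \<Rightarrow> tm) \<Rightarrow> tm \<Rightarrow> tm" where
  "subst_tm \<sigma> (Var i) = \<sigma> i"
| "subst_tm \<sigma> (OPair t u) = OPair (subst_tm \<sigma> t) (subst_tm \<sigma> u)"

definition lift_tm :: "tm \<Rightarrow> tm" where
  "lift_tm = subst_tm (\<lambda>i. Var (Suc i))"

definition up :: "(nat \<Rightarrow> tm) \<Rightarrow> nat \<Rightarrow> tm" where
  "up \<sigma> = case_nat (Var 0) (\<lambda>i. lift_tm (\<sigma> i))"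

primrec subst :: "(nat \<Rightarrow> tm) \<Rightarrow> fm \<Rightarrow> fm" where
  "subst \<sigma> Bot = Bot"
| "subst \<sigma> (t \<^bold>= u) = (subst_tm \<sigma> t \<^bold>= subst_tm \<sigma> u)"
| "subst \<sigma> (t \<^bold>\<in> u) = (subst_tm \<sigma> t \<^bold>\<in> subst_tm \<sigma> u)"
| "subst \<sigma> (SetP t) = SetP (subst_tm \<sigma> t)"
| "subst \<sigma> (p \<^bold>\<and> q) = (subst \<sigma> p \<^bold>\<and> subst \<sigma> q)"
| "subst \<sigma> (p \<^bold>\<or> q) = (subst \<sigma> p \<^bold>\<or> subst \<sigma> q)"
| "subst \<sigma> (p \<^bold>\<longrightarrow> q) = (subst \<sigma> p \<^bold>\<longrightarrow> subst \<sigma> q)"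
| "subst \<sigma> (All p) = All (subst (up \<sigma>) p)"
| "subst \<sigma> (Ex p) = Ex (subst (up \<sigma>) p)"

definition lift :: "fm \<Rightarrow> fm" where
  "lift = subst (\<lambda>i. Var (Suc i))"

text \<open>\<open>inst t p\<close> is the body \<open>p\<close> of a quantifier with \<open>t\<close> put for the bound variable.\<close>

definition inst :: "tm \<Rightarrow> fm \<Rightarrow> fm" where
  "inst t = subst (case_nat t Var)"

section \<open>Provability and consistency\<close>

datatype logic = Intuitionistic | Classical

text \<open>
  Natural deduction with equality. Lifting the hypotheses in \<open>AllI\<close> and \<open>ExE\<close> is the eigenvariable
  condition: the variable \<open>0\<close> is then fresh for them.
\<close>

inductive proves :: "logic \<Rightarrow> fm set \<Rightarrow> fm \<Rightarrow> bool" for L :: logic where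
  Assm: "p \<in> \<Gamma> \<Longrightarrow> proves L \<Gamma> p"
| BotE: "proves L \<Gamma> Bot \<Longrightarrow> proves L \<Gamma> p"
| AndI: "proves L \<Gamma> p \<Longrightarrow> proves L \<Gamma> q \<Longrightarrow> proves L \<Gamma> (p \<^bold>\<and> q)"
| AndE1: "proves L \<Gamma> (p \<^bold>\<and> q) \<Longrightarrow> proves L \<Gamma> p"
| AndE2: "proves L \<Gamma> (p \<^bold>\<and> q) \<Longrightarrow> proves L \<Gamma> q"
| OrI1: "proves L \<Gamma> p \<Longrightarrow> proves L \<Gamma> (p \<^bold>\<or> q)"
| OrI2: "proves L \<Gamma> q \<Longrightarrow> proves L \<Gamma> (p \<^bold>\<or> q)"
| OrE: "proves L \<Gamma> (p \<^bold>\<or> q) \<Longrightarrow> proves L (insert p \<Gamma>) r \<Longrightarrow> proves L (insert q \<Gamma>) r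
    \<Longrightarrow> proves L \<Gamma> r"
| ImpI: "proves L (insert p \<Gamma>) q \<Longrightarrow> proves L \<Gamma> (p \<^bold>\<longrightarrow> q)"
| ImpE: "proves L \<Gamma> (p \<^bold>\<longrightarrow> q) \<Longrightarrow> proves L \<Gamma> p \<Longrightarrow> proves L \<Gamma> q"
| AllI: "proves L (lift ` \<Gamma>) p \<Longrightarrow> proves L \<Gamma> (All p)"
| AllE: "proves L \<Gamma> (All p) \<Longrightarrow> proves L \<Gamma> (inst t p)"
| ExI: "proves L \<Gamma> (inst t p) \<Longrightarrow> proves L \<Gamma> (Ex p)"
| ExE: "proves L \<Gamma> (Ex p) \<Longrightarrow> proves L (insert p (lift ` \<Gamma>)) (lift q) \<Longrightarrow> proves L \<Gamma> q"
| EqRefl: "proves L \<Gamma> (t \<^bold>= t)"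
| EqSubst: "proves L \<Gamma> (t \<^bold>= u) \<Longrightarrow> proves L \<Gamma> (inst t p) \<Longrightarrow> proves L \<Gamma> (inst u p)"
| DNE: "L = Classical \<Longrightarrow> proves L \<Gamma> (Neg (Neg p)) \<Longrightarrow> proves L \<Gamma> p"

text \<open>A theory consists of its underlying logic and its axioms.\<close>

type_synonym fo_theory = "logic \<times> fm set"

definition consistent :: "fo_theory \<Rightarrow> bool" where
  "consistent T \<longleftrightarrow> \<not> proves (fst T) (snd T) Bot"

definition equiconsistent :: "fo_theory \<Rightarrow> fo_theory \<Rightarrow> bool" where
  "equiconsistent T U \<longleftrightarrow> (consistent T \<longleftrightarrow> consistent U)"

definition extend :: "fo_theory \<Rightarrow> fm \<Rightarrow> fo_theory" where
  "extend T p = (fst T, insert p (snd T))"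

section \<open>Stratification\<close>

text \<open>
  \<open>has_level s t n\<close>: extending the assignment \<open>s\<close> on variables to pairs by
  \<open>s \<langle>v, w\<rangle> = s v = s w\<close> is possible on \<open>t\<close> and gives \<open>t\<close> the level \<open>n\<close>.
  In \<open>strat s p\<close>, \<open>s\<close> is the assignment on the free variables of \<open>p\<close>; every bound variable,
  being distinct from all others, gets a level of its own.
\<close>

primrec has_level :: "(nat \<Rightarrow> nat) \<Rightarrow> tm \<Rightarrow> nat \<Rightarrow> bool" where
  "has_level s (Var i) n \<longleftrightarrow> s i = n"
| "has_level s (OPair t u) n \<longleftrightarrow> has_level s t n \<and> has_level s u n"

primrec strat :: "(nat \<Rightarrow> nat) \<Rightarrow> fm \<Rightarrow> bool" where
  "strat s Bot \<longleftrightarrow> True"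
| "strat s (t \<^bold>= u) \<longleftrightarrow> (\<exists>n. has_level s t n \<and> has_level s u n)"
| "strat s (t \<^bold>\<in> u) \<longleftrightarrow> (\<exists>n. has_level s t n \<and> has_level s u (n + 1))"
| "strat s (SetP t) \<longleftrightarrow> (\<exists>n. has_level s t n)"
| "strat s (p \<^bold>\<and> q) \<longleftrightarrow> strat s p \<and> strat s q"
| "strat s (p \<^bold>\<or> q) \<longleftrightarrow> strat s p \<and> strat s q"
| "strat s (p \<^bold>\<longrightarrow> q) \<longleftrightarrow> strat s p \<and> strat s q"
| "strat s (All p) \<longleftrightarrow> (\<exists>n. strat (case_nat n s) p)"
| "strat s (Ex p) \<longleftrightarrow> (\<exists>n. strat (case_nat n s) p)"

definition stratified :: "fm \<Rightarrow> bool" where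
  "stratified p \<longleftrightarrow> (\<exists>s. strat s p)"

section \<open>The set theories\<close>

text \<open>\<open>x = Var 1\<close>, \<open>y = Var 0\<close>; under the inner quantifier \<open>z = Var 0\<close>, \<open>x = Var 2\<close>, \<open>y = Var 1\<close>.\<close>

definition extensionality :: fm where
  "extensionality =
    (SetP (Var 1) \<^bold>\<and> SetP (Var 0) \<^bold>\<and> All (Var 0 \<^bold>\<in> Var 2 \<^bold>\<longleftrightarrow> Var 0 \<^bold>\<in> Var 1)
      \<^bold>\<longrightarrow> Var 1 \<^bold>= Var 0)"

text \<open>
  In \<open>\<phi>\<close>, \<open>Var 0\<close> is \<open>z\<close>, \<open>Var 1\<close> is \<open>x\<close> (not allowed to be free in \<open>\<phi>\<close>) and the remaining
  variables are parameters.
\<close>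

definition comprehension :: "fm \<Rightarrow> fm" where
  "comprehension \<phi> = Ex (SetP (Var 0) \<^bold>\<and> All (Var 0 \<^bold>\<in> Var 1 \<^bold>\<longleftrightarrow> \<phi>))"

text \<open>\<open>x, y, x', y'\<close> are \<open>Var 0, Var 1, Var 2, Var 3\<close>.\<close>

definition pair_injective :: fm where
  "pair_injective =
    (OPair (Var 0) (Var 1) \<^bold>= OPair (Var 2) (Var 3) \<^bold>\<longrightarrow> Var 0 \<^bold>= Var 2 \<^bold>\<and> Var 1 \<^bold>= Var 3)"

definition elements_only_in_sets :: fm where
  "elements_only_in_sets = (Var 0 \<^bold>\<in> Var 1 \<^bold>\<longrightarrow> SetP (Var 1))"

definition NFU_axioms :: "fm set" where
  "NFU_axioms = univ_closure `
    ({extensionality, pair_injective, elements_only_in_sets}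
      \<union> {comprehension \<phi> | \<phi>. stratified \<phi> \<and> 1 \<notin> fv \<phi>})"

definition NFU_Set :: fo_theory where
  "NFU_Set = (Classical, NFU_axioms)"

definition INFU_Set :: fo_theory where
  "INFU_Set = (Intuitionistic, NFU_axioms)"

definition NF_Set :: fo_theory where
  "NF_Set = extend NFU_Set (All (SetP (Var 0)))"

definition INF_Set :: fo_theory where
  "INF_Set = extend INFU_Set (All (SetP (Var 0)))"

section \<open>The sentence \<open>|V| = |P(V)|\<close>\<close>

text \<open>
  The formula stating that the variable \<open>f\<close> is a set of ordered pairs which is a bijection between
  the sets \<open>a\<close> and \<open>b\<close>. The five conjuncts after \<open>SetP\<close>: \<open>f\<close> is a subset of \<open>a \<times> b\<close>, total on
  \<open>a\<close>, single-valued, injective, and onto \<open>b\<close>.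
\<close>

definition bijection :: "nat \<Rightarrow> nat \<Rightarrow> nat \<Rightarrow> fm" where
  "bijection f a b =
    (SetP (Var f)
    \<^bold>\<and> All (Var 0 \<^bold>\<in> Var (f + 1) \<^bold>\<longrightarrow>
        Ex (Ex (Var 1 \<^bold>\<in> Var (a + 3) \<^bold>\<and> Var 0 \<^bold>\<in> Var (b + 3)
          \<^bold>\<and> Var 2 \<^bold>= OPair (Var 1) (Var 0))))
    \<^bold>\<and> All (Var 0 \<^bold>\<in> Var (a + 1) \<^bold>\<longrightarrow> Ex (OPair (Var 1) (Var 0) \<^bold>\<in> Var (f + 2)))
    \<^bold>\<and> All (All (All (OPair (Var 2) (Var 1) \<^bold>\<in> Var (f + 3) \<^bold>\<and> OPair (Var 2) (Var 0) \<^bold>\<in> Var (f + 3)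
        \<^bold>\<longrightarrow> Var 1 \<^bold>= Var 0)))
    \<^bold>\<and> All (All (All (OPair (Var 2) (Var 0) \<^bold>\<in> Var (f + 3) \<^bold>\<and> OPair (Var 1) (Var 0) \<^bold>\<in> Var (f + 3)
        \<^bold>\<longrightarrow> Var 2 \<^bold>= Var 1)))
    \<^bold>\<and> All (Var 0 \<^bold>\<in> Var (b + 1) \<^bold>\<longrightarrow> Ex (OPair (Var 0) (Var 1) \<^bold>\<in> Var (f + 2))))"

text \<open>\<open>is_comprehension a \<phi>\<close> says \<open>a = {x | \<phi>}\<close>, where \<open>Var 0\<close> is \<open>x\<close> in \<open>\<phi>\<close>.\<close>

definition is_comprehension :: "nat \<Rightarrow> fm \<Rightarrow> fm" where
  "is_comprehension a \<phi> = (SetP (Var a) \<^bold>\<and> All (Var 0 \<^bold>\<in> Var (a + 1) \<^bold>\<longleftrightarrow> \<phi>))"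

text \<open>From the outside in, the quantifiers bind \<open>V\<close>, \<open>P(V)\<close> and the bijection.\<close>

definition card_V_eq_card_PV :: fm where
  "card_V_eq_card_PV =
    Ex (Ex (is_comprehension 1 (Var 0 \<^bold>= Var 0) \<^bold>\<and> is_comprehension 0 (SetP (Var 0))
      \<^bold>\<and> Ex (bijection 0 2 1)))"

end

theory Submission
  imports Defs
begin

text \<open>
  One direction is immediate. If everything is a set then \<open>V\<close> and \<open>P(V)\<close> coincide, and
  \<open>{z | \<exists>x. z = \<langle>x, x\<rangle>}\<close>, which exists by stratified comprehension, is a bijection
  between them (\<open>NF_card_V_eq_card_PV\<close>).

  Conversely, let \<open>F\<close> be a bijection from \<open>V\<close> to \<open>P(V)\<close>. Read every object \<open>y\<close> as a code
  for the set \<open>F(y)\<close>: keep the domain, equality and pairing, let everything be a set, and let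
  \<open>x \<in> y\<close> mean \<open>x \<in> F(y)\<close>. This gives an interpretation of the theory in which everything is
  a set. Extensionality holds because \<open>F\<close> is injective. For comprehension, the set defined by
  the interpreted formula is \<open>F(y)\<close> for some \<open>y\<close>, because \<open>F\<close> is onto; it remains to see that
  the set exists. The obstacle is that the interpreted formula need not be stratified:
  ordered pairs have the level of their components, so \<open>x \<in> F(y)\<close> forces \<open>F\<close> to be one level
  above \<open>y\<close>, and \<open>y\<close> varies over all levels of the original formula. But \<open>F\<close> is a parameter. Give
  each level \<open>n\<close> a parameter \<open>G\<^sub>n\<close> of its own; the resulting formula is stratified
  (\<open>strat_typed_interp\<close>), so its comprehension axiom is available for all values of the
  parameters, and in particular when all of them are \<open>F\<close> (\<open>interp_comprehension\<close>). Nothing here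
  uses excluded middle, so the same argument serves both logics.

  The argument takes place inside the object theory. To keep derivations readable they are handled
  by forcing: the worlds are sets of hypotheses with finitely many free variables, the individuals
  are the terms, and a world forces what it proves. Since a fresh variable is always at hand,
  \<open>\<forall>\<close> can be introduced by proving all instances, and \<open>\<exists>\<close> can be eliminated by passing to a larger
  world that has a witness, without ever shifting the formulas already obtained.
\<close>

section \<open>Substitution\<close>

lemma subst_tm_comp: "subst_tm \<sigma> (subst_tm \<tau> t) = subst_tm (\<lambda>i. subst_tm \<sigma> (\<tau> i)) t"
  by (induction t) auto

lemma subst_tm_lift_tm: "subst_tm \<sigma> (lift_tm t) = subst_tm (\<lambda>i. \<sigma> (Suc i)) t"
  by (simp add: lift_tm_def subst_tm_comp)

lemma subst_tm_Var [simp]: "subst_tm Var t = t"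
  by (induction t) auto

lemma subst_tm_cong: "(\<And>i. i \<in> fv_tm t \<Longrightarrow> \<sigma> i = \<tau> i) \<Longrightarrow> subst_tm \<sigma> t = subst_tm \<tau> t"
  by (induction t) auto

lemma up_simps [simp]: "up \<sigma> 0 = Var 0" "up \<sigma> (Suc i) = lift_tm (\<sigma> i)"
  by (auto simp: up_def)

lemma up_Var [simp]: "up Var = Var"
  by (rule ext) (auto simp: up_def lift_tm_def split: nat.split)

lemma lift_tm_simps [simp]: "lift_tm (Var i) = Var (Suc i)"
    "lift_tm (OPair t u) = OPair (lift_tm t) (lift_tm u)"
  by (auto simp: lift_tm_def)

lemma subst_tm_up_lift_tm: "subst_tm (up \<sigma>) (lift_tm t) = lift_tm (subst_tm \<sigma> t)"
  by (simp add: subst_tm_lift_tm) (simp add: lift_tm_def subst_tm_comp)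

lemma subst_tm_case_lift_tm [simp]: "subst_tm (case_nat t \<sigma>) (lift_tm u) = subst_tm \<sigma> u"
  by (simp add: subst_tm_lift_tm)

lemma subst_tm_up_comp: "(\<lambda>i. subst_tm (up \<sigma>) (up \<tau> i)) = up (\<lambda>i. subst_tm \<sigma> (\<tau> i))"
  by (rule ext) (simp add: up_def[of \<tau>] up_def[of "\<lambda>i. subst_tm \<sigma> (\<tau> i)"]
      subst_tm_up_lift_tm split: nat.split)

lemma subst_tm_case_up: "(\<lambda>i. subst_tm (case_nat t \<sigma>) (up \<tau> i)) = case_nat t (\<lambda>i. subst_tm \<sigma> (\<tau> i))"
  by (rule ext) (simp add: up_def split: nat.split)

lemma subst_comp: "subst \<sigma> (subst \<tau> p) = subst (\<lambda>i. subst_tm \<sigma> (\<tau> i)) p"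
  by (induction p arbitrary: \<sigma> \<tau>) (auto simp: subst_tm_comp subst_tm_up_comp)

lemma subst_Var [simp]: "subst Var p = p"
  by (induction p) auto

lemma up_cong: "(\<And>i. Suc i \<in> A \<Longrightarrow> \<sigma> i = \<tau> i) \<Longrightarrow> i \<in> A \<Longrightarrow> up \<sigma> i = up \<tau> i"
  by (cases i) simp_all

lemma subst_cong: "(\<And>i. i \<in> fv p \<Longrightarrow> \<sigma> i = \<tau> i) \<Longrightarrow> subst \<sigma> p = subst \<tau> p"
proof (induction p arbitrary: \<sigma> \<tau>)
  case (All p)
  then have "subst (up \<sigma>) p = subst (up \<tau>) p"
    by (intro All.IH) (rule up_cong[of "fv p"], simp_all)
  then show ?case by simp
next
  case (Ex p)
  then have "subst (up \<sigma>) p = subst (up \<tau>) p"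
    by (intro Ex.IH) (rule up_cong[of "fv p"], simp_all)
  then show ?case by simp
next
  case (And p q)
  from And.IH[of \<sigma> \<tau>] And.prems show ?case by simp
next
  case (Or p q)
  from Or.IH[of \<sigma> \<tau>] Or.prems show ?case by simp
next
  case (Imp p q)
  from Imp.IH[of \<sigma> \<tau>] Imp.prems show ?case by simp
qed (auto intro: subst_tm_cong)

lemma inst_subst_up [simp]: "inst t (subst (up \<sigma>) p) = subst (case_nat t \<sigma>) p"
  by (simp add: inst_def subst_comp subst_tm_case_up)

lemma subst_inst: "subst \<sigma> (inst t p) = inst (subst_tm \<sigma> t) (subst (up \<sigma>) p)"
proof -
  have "(\<lambda>i. subst_tm \<sigma> (case_nat t Var i)) = case_nat (subst_tm \<sigma> t) \<sigma>"
    by (rule ext) (simp split: nat.split)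
  then show ?thesis by (simp add: subst_comp) (simp add: inst_def subst_comp)
qed

lemma subst_up_lift: "subst (up \<sigma>) (lift p) = lift (subst \<sigma> p)"
  by (simp add: lift_def subst_comp) (simp add: lift_tm_def)

lemma finite_fv_tm [simp]: "finite (fv_tm t)"
  by (induction t) auto

lemma finite_fv [simp]: "finite (fv p)"
proof (induction p)
  case (All p)
  from finite_vimageI[OF All, of Suc] show ?case by (simp add: vimage_def)
next
  case (Ex p)
  from finite_vimageI[OF Ex, of Suc] show ?case by (simp add: vimage_def)
qed simp_all

lemma fv_tm_lift_tm [simp]: "fv_tm (lift_tm t) = Suc ` fv_tm t"
  by (induction t) auto


section \<open>Derivations\<close>

lemma proves_weaken: "proves L \<Gamma> p \<Longrightarrow> \<Gamma> \<subseteq> \<Delta> \<Longrightarrow> proves L \<Delta> p"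
proof (induction arbitrary: \<Delta> rule: proves.induct)
  case (Assm p \<Gamma>)
  then show ?case by (intro proves.Assm) (rule subsetD)
next
  case (OrE \<Gamma> p q r)
  show ?case
    by (rule proves.OrE[OF OrE.IH]) (intro OrE.prems insert_mono)+
next
  case (ImpI p \<Gamma> q)
  show ?case by (rule proves.ImpI[OF ImpI.IH]) (intro ImpI.prems insert_mono)
next
  case (AllI \<Gamma> p)
  show ?case by (rule proves.AllI[OF AllI.IH]) (intro AllI.prems image_mono)
next
  case (ExE \<Gamma> p q)
  show ?case by (rule proves.ExE[OF ExE.IH]) (intro ExE.prems image_mono insert_mono)+
next
  case (DNE \<Gamma> p)
  show ?case by (rule proves.DNE[OF DNE.hyps(1) DNE.IH]) (rule DNE.prems)
next
  case (BotE \<Gamma> p)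
  show ?case by (rule proves.BotE[OF BotE.IH]) (rule BotE.prems)+
next
  case (AndI \<Gamma> p q)
  show ?case by (rule proves.AndI[OF AndI.IH]) (rule AndI.prems)+
next
  case (AndE1 \<Gamma> p q)
  show ?case by (rule proves.AndE1[OF AndE1.IH]) (rule AndE1.prems)+
next
  case (AndE2 \<Gamma> p q)
  show ?case by (rule proves.AndE2[OF AndE2.IH]) (rule AndE2.prems)+
next
  case (OrI1 \<Gamma> p q)
  show ?case by (rule proves.OrI1[OF OrI1.IH]) (rule OrI1.prems)+
next
  case (OrI2 \<Gamma> q p)
  show ?case by (rule proves.OrI2[OF OrI2.IH]) (rule OrI2.prems)+
next
  case (ImpE \<Gamma> p q)
  show ?case by (rule proves.ImpE[OF ImpE.IH]) (rule ImpE.prems)+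
next
  case (AllE \<Gamma> p t)
  show ?case by (rule proves.AllE[OF AllE.IH]) (rule AllE.prems)+
next
  case (ExI \<Gamma> t p)
  show ?case by (rule proves.ExI[OF ExI.IH]) (rule ExI.prems)+
next
  case (EqSubst \<Gamma> t u p)
  show ?case by (rule proves.EqSubst[OF EqSubst.IH]) (rule EqSubst.prems)+
qed (rule proves.EqRefl)

lemma proves_subst: "proves L \<Gamma> p \<Longrightarrow> proves L (subst \<sigma> ` \<Gamma>) (subst \<sigma> p)"
proof (induction arbitrary: \<sigma> rule: proves.induct)
  case (AndE1 \<Gamma> p q)
  from AndE1.IH[of \<sigma>] show ?case by simp (rule proves.AndE1)
next
  case (AndE2 \<Gamma> p q)
  from AndE2.IH[of \<sigma>] show ?case by simp (rule proves.AndE2)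
next
  case (OrE \<Gamma> p q r)
  from OrE.IH(1)[of \<sigma>] OrE.IH(2)[of \<sigma>] OrE.IH(3)[of \<sigma>] show ?case
    by simp (rule proves.OrE)
next
  case (ImpI p \<Gamma> q)
  from ImpI.IH[of \<sigma>] show ?case by (simp add: proves.ImpI)
next
  case (ImpE \<Gamma> p q)
  from ImpE.IH(1)[of \<sigma>] ImpE.IH(2)[of \<sigma>] show ?case by simp (rule proves.ImpE)
next
  case (AllI \<Gamma> p)
  have "subst (up \<sigma>) ` lift ` \<Gamma> = lift ` subst \<sigma> ` \<Gamma>"
    by (simp add: image_image subst_up_lift)
  with AllI.IH[of "up \<sigma>"] show ?case by (simp add: proves.AllI)
next
  case (AllE \<Gamma> p t)
  from AllE.IH[of \<sigma>] show ?case
    by (simp add: subst_inst del: inst_subst_up) (rule proves.AllE)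
next
  case (ExI \<Gamma> t p)
  from ExI.IH[of \<sigma>] show ?case
    by (simp add: subst_inst del: inst_subst_up) (rule proves.ExI)
next
  case (ExE \<Gamma> p q)
  have "subst (up \<sigma>) ` lift ` \<Gamma> = lift ` subst \<sigma> ` \<Gamma>"
    by (simp add: image_image subst_up_lift)
  with ExE.IH(1)[of \<sigma>] ExE.IH(2)[of "up \<sigma>"] show ?case
    by (simp add: subst_up_lift) (rule proves.ExE)
next
  case (EqSubst \<Gamma> t u p)
  from EqSubst.IH(1)[of \<sigma>] EqSubst.IH(2)[of \<sigma>] show ?case
    by (simp add: subst_inst del: inst_subst_up) (rule proves.EqSubst)
next
  case (DNE \<Gamma> p)
  from DNE.IH[of \<sigma>] show ?case by simp (rule proves.DNE[OF DNE.hyps(1)])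
next
  case (BotE \<Gamma> p)
  from BotE.IH[of \<sigma>] show ?case by simp (rule proves.BotE)
qed (simp_all add: proves.Assm proves.AndI proves.OrI1 proves.OrI2 proves.EqRefl)

text \<open>
  Finitely many free variables rather than finitely many formulas: the axioms are infinitely many,
  but they are sentences.
\<close>

definition world :: "fm set \<Rightarrow> bool" where
  "world \<Gamma> \<longleftrightarrow> finite (\<Union>(fv ` \<Gamma>))"

lemma world_insert [simp]: "world (insert p \<Gamma>) \<longleftrightarrow> world \<Gamma>"
  by (simp add: world_def)

lemma world_fresh:
  assumes "world \<Gamma>" "finite X"
  obtains i where "i \<notin> X" "\<And>p. p \<in> \<Gamma> \<Longrightarrow> i \<notin> fv p"
proof -
  have "finite (X \<union> \<Union>(fv ` \<Gamma>))" using assms by (simp add: world_def)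
  then obtain i where "i \<notin> X \<union> \<Union>(fv ` \<Gamma>)" using ex_new_if_finite[OF infinite_UNIV_nat] by metis
  then show thesis by (intro that[of i]) auto
qed

text \<open>
  The renaming that turns a derivation with free variable \<open>i\<close> into the premise of a quantifier rule,
  where the eigenvariable is \<open>0\<close> and all others are shifted.
\<close>

definition rebind :: "nat \<Rightarrow> nat \<Rightarrow> tm" where
  "rebind i j = (if j = i then Var 0 else Var (Suc j))"

lemma subst_rebind_fresh: "i \<notin> fv p \<Longrightarrow> subst (rebind i) p = lift p"
  unfolding lift_def by (rule subst_cong) (auto simp: rebind_def)

lemma subst_rebind_inst:
  assumes "i \<notin> fv (All p)" shows "subst (rebind i) (inst (Var i) p) = p"
proof -
  have "subst (rebind i) (inst (Var i) p)
      = subst (\<lambda>j. subst_tm (rebind i) (case_nat (Var i) Var j)) p"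
    by (simp add: inst_def subst_comp)
  also have "\<dots> = subst Var p"
    using assms by (intro subst_cong) (auto simp: rebind_def split: nat.split)
  finally show ?thesis by simp
qed

text \<open>
  For a variable \<open>i\<close> fresh for the context, the instance at \<open>i\<close> is as good as the instance at an
  eigenvariable.
\<close>

lemma proves_All_iff:
  assumes "world \<Gamma>"
  shows "proves L \<Gamma> (All p) \<longleftrightarrow> (\<forall>t. proves L \<Gamma> (inst t p))"
proof
  assume "proves L \<Gamma> (All p)"
  then show "\<forall>t. proves L \<Gamma> (inst t p)" by (intro allI proves.AllE)
next
  assume *: "\<forall>t. proves L \<Gamma> (inst t p)"
  obtain i where i: "i \<notin> fv (All p)" "\<And>q. q \<in> \<Gamma> \<Longrightarrow> i \<notin> fv q"
    by (rule world_fresh[OF assms finite_fv[of "All p"]]) blast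
  have "subst (rebind i) ` \<Gamma> = lift ` \<Gamma>"
    using i(2) by (intro image_cong refl subst_rebind_fresh)
  moreover have "proves L (subst (rebind i) ` \<Gamma>) (subst (rebind i) (inst (Var i) p))"
    using * by (intro proves_subst) (rule spec)
  ultimately have "proves L (lift ` \<Gamma>) p" by (simp only: subst_rebind_inst[OF i(1)])
  then show "proves L \<Gamma> (All p)" by (rule proves.AllI)
qed

text \<open>
  Only a variable is ever needed as a witness, but the statement hides this: a proof that uses the
  rule can treat the witness as an arbitrary term \<open>t\<close>, and nothing has to be lifted.
\<close>

lemma proves_Ex_elim:
  assumes "proves L \<Gamma> (Ex p)" "world \<Gamma>"
    and cont: "\<And>t \<Delta>. world \<Delta> \<Longrightarrow> \<Gamma> \<subseteq> \<Delta> \<Longrightarrow> proves L \<Delta> (inst t p) \<Longrightarrow> proves L \<Delta> q"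
  shows "proves L \<Gamma> q"
proof -
  have "finite (fv (All p) \<union> fv q)" by (simp only: finite_Un finite_fv)
  then obtain i where i: "i \<notin> fv (All p) \<union> fv q" "\<And>r. r \<in> \<Gamma> \<Longrightarrow> i \<notin> fv r"
    by (rule world_fresh[OF assms(2)]) blast
  let ?\<Delta> = "insert (inst (Var i) p) \<Gamma>"
  have "subst (rebind i) ` \<Gamma> = lift ` \<Gamma>"
    using i(2) by (intro image_cong refl subst_rebind_fresh)
  moreover have "proves L (subst (rebind i) ` ?\<Delta>) (subst (rebind i) q)"
    using assms(2) by (intro proves_subst cont[of ?\<Delta> "Var i"]) (auto intro: proves.Assm)
  moreover have "subst (rebind i) (inst (Var i) p) = p"
    using i(1) by (intro subst_rebind_inst) blast
  moreover have "subst (rebind i) q = lift q"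
    using i(1) by (intro subst_rebind_fresh) blast
  ultimately have "proves L (insert p (lift ` \<Gamma>)) (lift q)" by simp
  with assms(1) show ?thesis by (rule proves.ExE)
qed

lemma proves_Imp_iff:
  assumes "world \<Gamma>"
  shows "proves L \<Gamma> (p \<^bold>\<longrightarrow> q) \<longleftrightarrow>
    (\<forall>\<Delta>. world \<Delta> \<longrightarrow> \<Gamma> \<subseteq> \<Delta> \<longrightarrow> proves L \<Delta> p \<longrightarrow> proves L \<Delta> q)"
proof
  assume "proves L \<Gamma> (p \<^bold>\<longrightarrow> q)"
  then show "\<forall>\<Delta>. world \<Delta> \<longrightarrow> \<Gamma> \<subseteq> \<Delta> \<longrightarrow> proves L \<Delta> p \<longrightarrow> proves L \<Delta> q"
    by (meson proves.ImpE proves_weaken)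
next
  assume "\<forall>\<Delta>. world \<Delta> \<longrightarrow> \<Gamma> \<subseteq> \<Delta> \<longrightarrow> proves L \<Delta> p \<longrightarrow> proves L \<Delta> q"
  then have "proves L (insert p \<Gamma>) q"
    using assms by (metis proves.Assm insertI1 subset_insertI world_insert)
  then show "proves L \<Gamma> (p \<^bold>\<longrightarrow> q)" by (rule proves.ImpI)
qed

lemma proves_And_iff: "proves L \<Gamma> (p \<^bold>\<and> q) \<longleftrightarrow> proves L \<Gamma> p \<and> proves L \<Gamma> q"
  using proves.AndI proves.AndE1 proves.AndE2 by metis

text \<open>
  Next come the clauses of the forcing relation, with a formula evaluated under a substitution \<open>e\<close>
  of terms for its free variables. They are applied to formulas on which \<open>e\<close> has not yet been pushed
  under the connectives, hence the simplification calls below that delete \<open>subst.simps(5,7-9)\<close>.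
\<close>

lemma forces_All: "world \<Gamma> \<Longrightarrow>
    proves L \<Gamma> (subst e (All p)) \<longleftrightarrow> (\<forall>t. proves L \<Gamma> (subst (case_nat t e) p))"
  by (simp add: proves_All_iff)

lemma forces_And:
  "proves L \<Gamma> (subst e (p \<^bold>\<and> q)) \<longleftrightarrow> proves L \<Gamma> (subst e p) \<and> proves L \<Gamma> (subst e q)"
  by (simp add: proves_And_iff)

lemma forces_Imp: "world \<Gamma> \<Longrightarrow> proves L \<Gamma> (subst e (p \<^bold>\<longrightarrow> q)) \<longleftrightarrow>
    (\<forall>\<Delta>. world \<Delta> \<longrightarrow> \<Gamma> \<subseteq> \<Delta> \<longrightarrow> proves L \<Delta> (subst e p) \<longrightarrow> proves L \<Delta> (subst e q))"
  by (simp add: proves_Imp_iff)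

lemma forces_ExI: "proves L \<Gamma> (subst (case_nat t e) p) \<Longrightarrow> proves L \<Gamma> (subst e (Ex p))"
  by (simp add: proves.ExI[where t = t])

lemma forces_ExE:
  assumes "proves L \<Gamma> (subst e (Ex p))" "world \<Gamma>"
    and "\<And>t \<Delta>. world \<Delta> \<Longrightarrow> \<Gamma> \<subseteq> \<Delta> \<Longrightarrow> proves L \<Delta> (subst (case_nat t e) p) \<Longrightarrow> proves L \<Delta> q"
  shows "proves L \<Gamma> q"
proof (rule proves_Ex_elim[OF assms(1)[unfolded subst.simps] assms(2)])
  fix t \<Delta>
  assume "world \<Delta>" "\<Gamma> \<subseteq> \<Delta>" "proves L \<Delta> (inst t (subst (up e) p))"
  then show "proves L \<Delta> q" unfolding inst_subst_up by (rule assms(3))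
qed

lemmas forces = forces_All forces_And forces_Imp

lemma proves_Eq_sym: "proves L \<Gamma> (t \<^bold>= u) \<Longrightarrow> proves L \<Gamma> (u \<^bold>= t)"
  using proves.EqSubst[of L \<Gamma> t u "Var 0 \<^bold>= lift_tm t"]
  by (simp add: inst_def proves.EqRefl)

lemma proves_Eq_trans:
  "proves L \<Gamma> (t \<^bold>= u) \<Longrightarrow> proves L \<Gamma> (u \<^bold>= v) \<Longrightarrow> proves L \<Gamma> (t \<^bold>= v)"
  using proves.EqSubst[of L \<Gamma> u v "lift_tm t \<^bold>= Var 0"] by (simp add: inst_def)

lemma proves_Mem_cong:
  assumes "proves L \<Gamma> (t \<^bold>= t')" "proves L \<Gamma> (u \<^bold>= u')" "proves L \<Gamma> (t \<^bold>\<in> u)"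
  shows "proves L \<Gamma> (t' \<^bold>\<in> u')"
  using proves.EqSubst[OF assms(1), of "Var 0 \<^bold>\<in> lift_tm u"]
    proves.EqSubst[OF assms(2), of "lift_tm t' \<^bold>\<in> Var 0"] assms(3)
  by (simp add: inst_def)

lemma proves_SetP_cong: "proves L \<Gamma> (t \<^bold>= u) \<Longrightarrow> proves L \<Gamma> (SetP t) \<Longrightarrow> proves L \<Gamma> (SetP u)"
  using proves.EqSubst[of L \<Gamma> t u "SetP (Var 0)"] by (simp add: inst_def)

lemma proves_OPair_cong:
  assumes "proves L \<Gamma> (t \<^bold>= t')" "proves L \<Gamma> (u \<^bold>= u')"
  shows "proves L \<Gamma> (OPair t u \<^bold>= OPair t' u')"
  using proves.EqSubst[OF assms(1), of "OPair (lift_tm t) (lift_tm u) \<^bold>= OPair (Var 0) (lift_tm u)"]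
    proves.EqSubst[OF assms(2), of "OPair (lift_tm t) (lift_tm u) \<^bold>= OPair (lift_tm t') (Var 0)"]
  by (simp add: inst_def proves.EqRefl)

lemma proves_cut: "proves L (insert p \<Gamma>) q \<Longrightarrow> proves L \<Gamma> p \<Longrightarrow> proves L \<Gamma> q"
  by (rule proves.ImpE[OF proves.ImpI])

section \<open>Universal closures\<close>

lemma fv_All_funpow: "fv ((All ^^ n) p) = {i. i + n \<in> fv p}"
  by (induction n) auto

lemma fv_univ_closure_bound: "fv p \<subseteq> {..<(LEAST n. fv p \<subseteq> {..<n})}"
proof -
  have "\<exists>n. fv p \<subseteq> {..<n}"
    using finite_fv[of p] unfolding finite_nat_set_iff_bounded by auto
  then show ?thesis by (rule LeastI_ex)
qed

lemma fv_univ_closure [simp]: "fv (univ_closure p) = {}"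
  using fv_univ_closure_bound[of p] by (auto simp: univ_closure_def fv_All_funpow)

text \<open>
  Stripping \<open>n\<close> universal quantifiers leaves the values at the first \<open>n\<close> variables free to choose;
  the other variables are shifted by \<open>n\<close>.
\<close>

lemma proves_All_funpow:
  "proves L \<Gamma> (subst e ((All ^^ n) p)) \<Longrightarrow> (\<And>j. e' (n + j) = e j) \<Longrightarrow> proves L \<Gamma> (subst e' p)"
proof (induction n arbitrary: e)
  case 0
  then have "e' = e" by auto
  with 0 show ?case by simp
next
  case (Suc n)
  have "proves L \<Gamma> (inst (e' n) (subst (up e) ((All ^^ n) p)))"
    using Suc.prems(1) by (intro proves.AllE) simp
  moreover have "e' (n + j) = case_nat (e' n) e j" for j
    using Suc.prems(2)[of "j - 1"] by (cases j) auto
  ultimately show ?case by (auto intro!: Suc.IH[of "case_nat (e' n) e"])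
qed

lemma proves_univ_closure:
  assumes "proves L \<Gamma> (univ_closure p)" shows "proves L \<Gamma> (subst e p)"
proof -
  let ?n = "LEAST n. fv p \<subseteq> {..<n}"
  let ?e' = "\<lambda>i. if i < ?n then e i else Var (i - ?n)"
  have "proves L \<Gamma> (subst Var ((All ^^ ?n) p))"
    using assms by (simp add: univ_closure_def)
  then have "proves L \<Gamma> (subst ?e' p)" by (rule proves_All_funpow) simp
  moreover have "subst ?e' p = subst e p"
    using fv_univ_closure_bound[of p] by (intro subst_cong) auto
  ultimately show ?thesis by simp
qed

section \<open>NF and the bijection\<close>

locale NFU_world =
  fixes L :: logic and \<Gamma> :: "fm set"
  assumes world: "world \<Gamma>" and axioms: "NFU_axioms \<subseteq> \<Gamma>"
begin

lemma axiom_instance: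
  assumes "p \<in> {extensionality, pair_injective, elements_only_in_sets}
      \<union> {comprehension \<phi> | \<phi>. stratified \<phi> \<and> 1 \<notin> fv \<phi>}"
  shows "proves L \<Gamma> (subst e p)"
  using assms axioms by (intro proves_univ_closure proves.Assm) (auto simp: NFU_axioms_def)

lemma extensional:
  assumes "proves L \<Gamma> (SetP t)" "proves L \<Gamma> (SetP u)"
    and "\<And>x \<Delta>. world \<Delta> \<Longrightarrow> \<Gamma> \<subseteq> \<Delta> \<Longrightarrow> proves L \<Delta> (x \<^bold>\<in> t) \<longleftrightarrow> proves L \<Delta> (x \<^bold>\<in> u)"
  shows "proves L \<Gamma> (t \<^bold>= u)"
proof -
  have "proves L \<Gamma> (subst (case_nat u (case_nat t Var)) extensionality)"
    by (intro axiom_instance) simp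
  then show ?thesis
    unfolding extensionality_def using assms world
    by (simp add: forces eval_nat_numeral del: subst.simps(5,7-9))
qed

lemma pair_injD:
  assumes "proves L \<Gamma> (OPair t u \<^bold>= OPair t' u')"
  shows "proves L \<Gamma> (t \<^bold>= t')" "proves L \<Gamma> (u \<^bold>= u')"
proof -
  have "proves L \<Gamma> (subst (case_nat t (case_nat u (case_nat t' (case_nat u' Var)))) pair_injective)"
    by (intro axiom_instance) simp
  with assms show "proves L \<Gamma> (t \<^bold>= t')" "proves L \<Gamma> (u \<^bold>= u')"
    unfolding pair_injective_def using world
    by (auto simp add: forces eval_nat_numeral simp del: subst.simps(5,7-9))
qed

lemma comprehensionE:
  assumes "stratified \<phi>" "1 \<notin> fv \<phi>"
    and "\<And>a \<Delta>. NFU_world \<Delta> \<Longrightarrow> \<Gamma> \<subseteq> \<Delta> \<Longrightarrow> proves L \<Delta> (SetP a) \<Longrightarrow>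
      (\<And>t \<Theta>. world \<Theta> \<Longrightarrow> \<Delta> \<subseteq> \<Theta> \<Longrightarrow>
        proves L \<Theta> (t \<^bold>\<in> a) \<longleftrightarrow> proves L \<Theta> (subst (case_nat t (case_nat a e)) \<phi>)) \<Longrightarrow>
      proves L \<Delta> q"
  shows "proves L \<Gamma> q"
proof -
  have "proves L \<Gamma> (subst e (comprehension \<phi>))"
    using assms by (intro axiom_instance) auto
  then show ?thesis
    unfolding comprehension_def
  proof (rule forces_ExE[OF _ world])
    fix a \<Delta>
    assume \<Delta>: "world \<Delta>" "\<Gamma> \<subseteq> \<Delta>"
      and a: "proves L \<Delta> (subst (case_nat a e) (SetP (Var 0) \<^bold>\<and> All (Var 0 \<^bold>\<in> Var 1 \<^bold>\<longleftrightarrow> \<phi>)))"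
    show "proves L \<Delta> q"
    proof (rule assms(3)[of \<Delta> a])
      show "NFU_world \<Delta>" using \<Delta> axioms by (auto simp: NFU_world_def)
      show "proves L \<Delta> (SetP a)" using a by (simp add: forces_And del: subst.simps(5))
      fix t \<Theta> assume \<Theta>: "world \<Theta>" "\<Delta> \<subseteq> \<Theta>"
      have "proves L \<Delta> (subst (case_nat t (case_nat a e)) (Var 0 \<^bold>\<in> Var 1 \<^bold>\<longleftrightarrow> \<phi>))"
        using a unfolding forces_And forces_All[OF \<Delta>(1)] by blast
      then show "proves L \<Theta> (t \<^bold>\<in> a)
          \<longleftrightarrow> proves L \<Theta> (subst (case_nat t (case_nat a e)) \<phi>)"
        unfolding forces_And forces_Imp[OF \<Delta>(1)] using \<Theta> by simp blast
    qed fact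
  qed
qed

end

lemma world_NFU_axioms: "world NFU_axioms"
  by (simp add: world_def NFU_axioms_def)

lemma NFU_world_mono: "NFU_world \<Gamma> \<Longrightarrow> world \<Delta> \<Longrightarrow> \<Gamma> \<subseteq> \<Delta> \<Longrightarrow> NFU_world \<Delta>"
  by (auto simp: NFU_world_def)

lemma inst_atoms [simp]:
  "inst a (t \<^bold>= u) = (subst_tm (case_nat a Var) t \<^bold>= subst_tm (case_nat a Var) u)"
  "inst a (t \<^bold>\<in> u) = (subst_tm (case_nat a Var) t \<^bold>\<in> subst_tm (case_nat a Var) u)"
  "inst a (p \<^bold>\<and> q) = (inst a p \<^bold>\<and> inst a q)"
  by (simp_all add: inst_def)

text \<open>
  The conjuncts of the formula, each read off in all larger worlds. The existential
  conclusions stay syntactic because a world that proves an existential statement need not prove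
  any instance of it.
\<close>

lemma proves_bijection_iff:
  assumes "world \<Gamma>"
  shows "proves L \<Gamma> (subst e (bijection f a b)) \<longleftrightarrow>
    proves L \<Gamma> (SetP (e f)) \<and>
    (\<forall>t \<Delta>. world \<Delta> \<longrightarrow> \<Gamma> \<subseteq> \<Delta> \<longrightarrow> proves L \<Delta> (t \<^bold>\<in> e f) \<longrightarrow>
      proves L \<Delta> (Ex (Ex (Var 1 \<^bold>\<in> lift_tm (lift_tm (e a)) \<^bold>\<and> Var 0 \<^bold>\<in> lift_tm (lift_tm (e b))
        \<^bold>\<and> lift_tm (lift_tm t) \<^bold>= OPair (Var 1) (Var 0))))) \<and>
    (\<forall>t \<Delta>. world \<Delta> \<longrightarrow> \<Gamma> \<subseteq> \<Delta> \<longrightarrow> proves L \<Delta> (t \<^bold>\<in> e a) \<longrightarrow>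
      proves L \<Delta> (Ex (OPair (lift_tm t) (Var 0) \<^bold>\<in> lift_tm (e f)))) \<and>
    (\<forall>t u v \<Delta>. world \<Delta> \<longrightarrow> \<Gamma> \<subseteq> \<Delta> \<longrightarrow>
      proves L \<Delta> (OPair t u \<^bold>\<in> e f) \<and> proves L \<Delta> (OPair t v \<^bold>\<in> e f) \<longrightarrow> proves L \<Delta> (u \<^bold>= v)) \<and>
    (\<forall>t u v \<Delta>. world \<Delta> \<longrightarrow> \<Gamma> \<subseteq> \<Delta> \<longrightarrow>
      proves L \<Delta> (OPair t v \<^bold>\<in> e f) \<and> proves L \<Delta> (OPair u v \<^bold>\<in> e f) \<longrightarrow> proves L \<Delta> (t \<^bold>= u)) \<and>
    (\<forall>t \<Delta>. world \<Delta> \<longrightarrow> \<Gamma> \<subseteq> \<Delta> \<longrightarrow> proves L \<Delta> (t \<^bold>\<in> e b) \<longrightarrow>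
      proves L \<Delta> (Ex (OPair (Var 0) (lift_tm t) \<^bold>\<in> lift_tm (e f))))"
  unfolding bijection_def using assms
  by (simp add: forces del: subst.simps(5,7-9)) (simp add: eval_nat_numeral)

lemma proves_is_comprehension_iff:
  assumes "world \<Gamma>"
  shows "proves L \<Gamma> (subst e (is_comprehension a \<phi>)) \<longleftrightarrow>
    proves L \<Gamma> (SetP (e a)) \<and>
    (\<forall>t \<Delta>. world \<Delta> \<longrightarrow> \<Gamma> \<subseteq> \<Delta> \<longrightarrow>
      (proves L \<Delta> (t \<^bold>\<in> e a) \<longleftrightarrow> proves L \<Delta> (subst (case_nat t e) \<phi>)))"
  unfolding is_comprehension_def using assms
  by (auto simp add: forces simp del: subst.simps(5,7-9))

text \<open>
  The universal set \<open>v\<close> serves as both \<open>V\<close> and \<open>P(V)\<close>, and the diagonal \<open>f\<close> of \<open>v \<times> v\<close> as the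
  bijection. Its definition is stratified since a pair has the level of its components.
\<close>

lemma NF_card_V_eq_card_PV:
  assumes "NFU_world \<Gamma>" and all_sets: "proves L \<Gamma> (All (SetP (Var 0)))"
  shows "proves L \<Gamma> card_V_eq_card_PV"
proof -
  interpret NFU_world L \<Gamma> by fact
  have SetP: "proves L \<Delta> (SetP t)" if "\<Gamma> \<subseteq> \<Delta>" for \<Delta> t
    using proves.AllE[OF proves_weaken[OF all_sets that], of t] by (simp add: inst_def)
  have "stratified (Var 0 \<^bold>= Var 0)" by (simp add: stratified_def)
  then show ?thesis
  proof (rule comprehensionE[where e = Var])
    fix v \<Delta>
    assume \<Delta>: "NFU_world \<Delta>" "\<Gamma> \<subseteq> \<Delta>"
      and v: "\<And>t \<Theta>. world \<Theta> \<Longrightarrow> \<Delta> \<subseteq> \<Theta> \<Longrightarrow> proves L \<Theta> (t \<^bold>\<in> v)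
        \<longleftrightarrow> proves L \<Theta> (subst (case_nat t (case_nat v Var)) (Var 0 \<^bold>= Var 0))"
    let ?diag = "Ex (Var 1 \<^bold>= OPair (Var 0) (Var 0))"
    interpret \<Delta>: NFU_world L \<Delta> by fact
    have "strat (\<lambda>_. 0) ?diag" by (auto intro!: exI[of _ 0])
    then have "stratified ?diag" by (auto simp: stratified_def)
    then show "proves L \<Delta> card_V_eq_card_PV"
    proof (rule \<Delta>.comprehensionE[where e = Var])
      fix f \<Theta>
      assume \<Theta>: "NFU_world \<Theta>" "\<Delta> \<subseteq> \<Theta>"
        and f: "\<And>t \<Xi>. world \<Xi> \<Longrightarrow> \<Theta> \<subseteq> \<Xi> \<Longrightarrow> proves L \<Xi> (t \<^bold>\<in> f)
          \<longleftrightarrow> proves L \<Xi> (subst (case_nat t (case_nat f Var)) ?diag)"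
      have w: "world \<Theta>" using \<Theta>(1) by (simp add: NFU_world_def)
      have in_v: "proves L \<Xi> (t \<^bold>\<in> v)" if "world \<Xi>" "\<Theta> \<subseteq> \<Xi>" for t \<Xi>
        using v[OF that(1)] that \<Theta>(2) by (auto intro: proves.EqRefl)
      have f_iff: "proves L \<Xi> (t \<^bold>\<in> f) \<longleftrightarrow>
          proves L \<Xi> (Ex (lift_tm t \<^bold>= OPair (Var 0) (Var 0)))" if "world \<Xi>" "\<Theta> \<subseteq> \<Xi>" for t \<Xi>
        using f[OF that] by simp
      have pair_iff: "proves L \<Xi> (OPair t u \<^bold>\<in> f) \<longleftrightarrow> proves L \<Xi> (t \<^bold>= u)"
        if \<Xi>: "world \<Xi>" "\<Theta> \<subseteq> \<Xi>" for t u \<Xi>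
      proof
        assume "proves L \<Xi> (OPair t u \<^bold>\<in> f)"
        then have "proves L \<Xi> (Ex (lift_tm (OPair t u) \<^bold>= OPair (Var 0) (Var 0)))"
          by (simp only: f_iff[OF \<Xi>])
        then show "proves L \<Xi> (t \<^bold>= u)"
        proof (rule proves_Ex_elim[OF _ \<Xi>(1)])
          fix r \<Omega>
          assume \<Omega>: "world \<Omega>" "\<Xi> \<subseteq> \<Omega>"
            and "proves L \<Omega> (inst r (lift_tm (OPair t u) \<^bold>= OPair (Var 0) (Var 0)))"
          then have eq: "proves L \<Omega> (OPair t u \<^bold>= OPair r r)" by simp
          interpret \<Omega>: NFU_world L \<Omega>
            using NFU_world_mono[OF \<Theta>(1) \<Omega>(1)] \<Xi>(2) \<Omega>(2) by blast
          show "proves L \<Omega> (t \<^bold>= u)"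
            using \<Omega>.pair_injD[OF eq] by (blast intro: proves_Eq_trans proves_Eq_sym)
        qed
      next
        assume "proves L \<Xi> (t \<^bold>= u)"
        then have "proves L \<Xi> (OPair t u \<^bold>= OPair u u)"
          by (intro proves_OPair_cong proves.EqRefl)
        then have "proves L \<Xi> (Ex (lift_tm (OPair t u) \<^bold>= OPair (Var 0) (Var 0)))"
          by (intro proves.ExI[where t = u]) simp
        then show "proves L \<Xi> (OPair t u \<^bold>\<in> f)" by (simp only: f_iff[OF \<Xi>])
      qed
      let ?e = "case_nat f (case_nat v (case_nat v Var))"
      have "proves L \<Theta> (subst ?e (bijection 0 2 1))"
        unfolding proves_bijection_iff[OF w]
      proof (intro conjI allI impI, goal_cases)
        case 1
        show ?case using \<Delta>(2) \<Theta>(2) by (intro SetP) auto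
      next
        case (2 t \<Xi>)
        then have "proves L \<Xi> (Ex (lift_tm t \<^bold>= OPair (Var 0) (Var 0)))" by (simp add: f_iff)
        then show ?case
        proof (rule proves_Ex_elim[OF _ 2(1)])
          fix r \<Omega>
          assume \<Omega>: "world \<Omega>" "\<Xi> \<subseteq> \<Omega>"
            and "proves L \<Omega> (inst r (lift_tm t \<^bold>= OPair (Var 0) (Var 0)))"
          then have "proves L \<Omega> (t \<^bold>= OPair r r)" by simp
          moreover have "proves L \<Omega> (r \<^bold>\<in> v)" using 2 \<Omega> by (intro in_v) auto
          ultimately show "proves L \<Omega> (Ex (Ex (Var 1 \<^bold>\<in> lift_tm (lift_tm (?e 2)) \<^bold>\<and>
              Var 0 \<^bold>\<in> lift_tm (lift_tm (?e 1)) \<^bold>\<and> lift_tm (lift_tm t) \<^bold>= OPair (Var 1) (Var 0))))"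
            by (intro proves.ExI[where t = r])
              (auto simp: inst_def subst_tm_up_lift_tm numeral_2_eq_2
                intro!: proves.ExI[where t = r] proves.AndI)
        qed
      next
        case (3 t \<Xi>)
        then show ?case
          by (intro proves.ExI[where t = t]) (simp add: pair_iff proves.EqRefl)
      next
        case (4 t u r \<Xi>)
        then show ?case by (auto simp: pair_iff intro: proves_Eq_trans proves_Eq_sym)
      next
        case (5 t u r \<Xi>)
        then show ?case by (auto simp: pair_iff intro: proves_Eq_trans proves_Eq_sym)
      next
        case (6 t \<Xi>)
        then show ?case
          by (intro proves.ExI[where t = t]) (simp add: pair_iff proves.EqRefl)
      qed
      then have "proves L \<Theta> (subst Var card_V_eq_card_PV)"
        unfolding card_V_eq_card_PV_def using in_v w SetP \<Delta>(2) \<Theta>(2)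
        by (intro forces_ExI[where t = v]) (auto simp add: forces_And proves_is_comprehension_iff
            simp del: subst.simps(5,9) intro!: forces_ExI[where t = f] proves.EqRefl)
      then show "proves L \<Theta> card_V_eq_card_PV" by simp
    qed simp
  qed simp
qed

section \<open>Membership through a bijection\<close>

text \<open>
  \<open>t \<in> F(u)\<close>, for a function \<open>F\<close> given as a set of pairs.
\<close>

definition mem_via :: "tm \<Rightarrow> tm \<Rightarrow> tm \<Rightarrow> fm" where
  "mem_via F t u = Ex (OPair (lift_tm u) (Var 0) \<^bold>\<in> lift_tm F \<^bold>\<and> lift_tm t \<^bold>\<in> Var 0)"

lemma subst_mem_via [simp]:
  "subst \<sigma> (mem_via F t u) = mem_via (subst_tm \<sigma> F) (subst_tm \<sigma> t) (subst_tm \<sigma> u)"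
  by (simp add: mem_via_def subst_tm_up_lift_tm)

text \<open>
  The interpretation through \<open>F\<close>, with terms \<open>e\<close> put for the free variables at the same time. As
  \<open>F\<close> is a term of the surrounding language and not a variable of the interpreted formula, no clash
  of names can arise.
\<close>

primrec interp :: "tm \<Rightarrow> (nat \<Rightarrow> tm) \<Rightarrow> fm \<Rightarrow> fm" where
  "interp F e Bot = Bot"
| "interp F e (t \<^bold>= u) = (subst_tm e t \<^bold>= subst_tm e u)"
| "interp F e (t \<^bold>\<in> u) = mem_via F (subst_tm e t) (subst_tm e u)"
| "interp F e (SetP t) = Neg Bot"
| "interp F e (p \<^bold>\<and> q) = (interp F e p \<^bold>\<and> interp F e q)"
| "interp F e (p \<^bold>\<or> q) = (interp F e p \<^bold>\<or> interp F e q)"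
| "interp F e (p \<^bold>\<longrightarrow> q) = (interp F e p \<^bold>\<longrightarrow> interp F e q)"
| "interp F e (All p) = All (interp (lift_tm F) (up e) p)"
| "interp F e (Ex p) = Ex (interp (lift_tm F) (up e) p)"

lemma subst_interp:
  "subst \<sigma> (interp F e p) = interp (subst_tm \<sigma> F) (\<lambda>i. subst_tm \<sigma> (e i)) p"
  by (induction p arbitrary: \<sigma> F e) (auto simp: subst_tm_comp subst_tm_up_comp subst_tm_up_lift_tm)

lemma inst_interp [simp]: "inst t (interp (lift_tm F) (up e) p) = interp F (case_nat t e) p"
  by (simp add: inst_def subst_interp subst_tm_case_up)

lemma interp_subst: "interp F e (subst \<sigma> p) = interp F (\<lambda>i. subst_tm e (\<sigma> i)) p"
  by (induction p arbitrary: F e \<sigma>) (auto simp: subst_tm_comp subst_tm_up_comp)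

lemma interp_forces_All: "world \<Gamma> \<Longrightarrow>
    proves L \<Gamma> (interp F e (All p)) \<longleftrightarrow> (\<forall>t. proves L \<Gamma> (interp F (case_nat t e) p))"
  by (simp add: proves_All_iff)

lemma interp_forces_And:
  "proves L \<Gamma> (interp F e (p \<^bold>\<and> q)) \<longleftrightarrow> proves L \<Gamma> (interp F e p) \<and> proves L \<Gamma> (interp F e q)"
  unfolding interp.simps by (rule proves_And_iff)

lemma interp_forces_Imp: "world \<Gamma> \<Longrightarrow> proves L \<Gamma> (interp F e (p \<^bold>\<longrightarrow> q)) \<longleftrightarrow>
    (\<forall>\<Delta>. world \<Delta> \<longrightarrow> \<Gamma> \<subseteq> \<Delta> \<longrightarrow> proves L \<Delta> (interp F e p) \<longrightarrow> proves L \<Delta> (interp F e q))"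
  by (simp add: proves_Imp_iff)

lemma interp_lift [simp]: "interp F (case_nat t e) (lift p) = interp F e p"
  by (simp add: lift_def interp_subst)

lemma interp_inst: "interp F e (inst t p) = interp F (case_nat (subst_tm e t) e) p"
proof -
  have "(\<lambda>i. subst_tm e (case_nat t Var i)) = case_nat (subst_tm e t) e"
    by (rule ext) (simp split: nat.split)
  then show ?thesis by (simp add: inst_def interp_subst)
qed

lemma interp_cong: "(\<And>i. i \<in> fv p \<Longrightarrow> e i = e' i) \<Longrightarrow> interp F e p = interp F e' p"
proof (induction p arbitrary: F e e')
  case (All p)
  then have "interp (lift_tm F) (up e) p = interp (lift_tm F) (up e') p"
    by (intro All.IH) (rule up_cong[of "fv p"], simp_all)
  then show ?case by simp
next
  case (Ex p)
  then have "interp (lift_tm F) (up e) p = interp (lift_tm F) (up e') p"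
    by (intro Ex.IH) (rule up_cong[of "fv p"], simp_all)
  then show ?case by simp
next
  case (And p q)
  from And.IH[of e e'] And.prems show ?case by simp
next
  case (Or p q)
  from Or.IH[of e e'] Or.prems show ?case by simp
next
  case (Imp p q)
  from Imp.IH[of e e'] Imp.prems show ?case by simp
next
  case (Eq t u)
  then show ?case using subst_tm_cong[of t e e'] subst_tm_cong[of u e e'] by simp
next
  case (Mem t u)
  then show ?case using subst_tm_cong[of t e e'] subst_tm_cong[of u e e'] by simp
qed simp_all

text \<open>
  Every rule of inference commutes with the interpretation, whatever \<open>F\<close> is; the properties of \<open>F\<close>
  matter only for the axioms.
\<close>

theorem interp_sound:
  "proves L A p \<Longrightarrow> world \<Gamma> \<Longrightarrow> (\<And>q. q \<in> A \<Longrightarrow> proves L \<Gamma> (interp F e q)) \<Longrightarrow>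
    proves L \<Gamma> (interp F e p)"
proof (induction arbitrary: \<Gamma> e rule: proves.induct)
  case (Assm p A)
  then show ?case by blast
next
  case (BotE A p)
  from BotE.IH[OF BotE.prems] show ?case by simp (rule proves.BotE)
next
  case (AndI A p q)
  from AndI.IH(1)[OF AndI.prems] AndI.IH(2)[OF AndI.prems] show ?case by (simp add: proves.AndI)
next
  case (AndE1 A p q)
  from AndE1.IH[OF AndE1.prems] show ?case by (simp add: proves_And_iff)
next
  case (AndE2 A p q)
  from AndE2.IH[OF AndE2.prems] show ?case by (simp add: proves_And_iff)
next
  case (OrI1 A p q)
  from OrI1.IH[OF OrI1.prems] show ?case by (simp add: proves.OrI1)
next
  case (OrI2 A q p)
  from OrI2.IH[OF OrI2.prems] show ?case by (simp add: proves.OrI2)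
next
  case (OrE A p q r)
  have "proves L \<Gamma> (interp F e p \<^bold>\<or> interp F e q)"
    using OrE.IH(1)[OF OrE.prems] by simp
  then show ?case
  proof (rule proves.OrE)
    show "proves L (insert (interp F e p) \<Gamma>) (interp F e r)"
      using OrE.prems by (intro OrE.IH(2)) (auto intro: proves.Assm proves_weaken)
    show "proves L (insert (interp F e q) \<Gamma>) (interp F e r)"
      using OrE.prems by (intro OrE.IH(3)) (auto intro: proves.Assm proves_weaken)
  qed
next
  case (ImpI p A q)
  have "proves L (insert (interp F e p) \<Gamma>) (interp F e q)"
    using ImpI.prems by (intro ImpI.IH) (auto intro: proves.Assm proves_weaken)
  then show ?case by (simp add: proves.ImpI)
next
  case (ImpE A p q)
  from ImpE.IH(1)[OF ImpE.prems] ImpE.IH(2)[OF ImpE.prems] show ?case by simp (rule proves.ImpE)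
next
  case (AllI A p)
  have "proves L \<Gamma> (interp F (case_nat t e) p)" for t
    using AllI.prems by (intro AllI.IH) auto
  then show ?case using AllI.prems(1) by (simp add: proves_All_iff)
next
  case (AllE A p t)
  from AllE.IH[OF AllE.prems] show ?case
    using AllE.prems(1) by (simp add: proves_All_iff interp_inst)
next
  case (ExI A t p)
  from ExI.IH[OF ExI.prems] show ?case
    by (simp add: interp_inst proves.ExI[where t = "subst_tm e t"])
next
  case (ExE A p q)
  have "proves L \<Gamma> (Ex (interp (lift_tm F) (up e) p))"
    using ExE.IH(1)[OF ExE.prems] by simp
  then show ?case
  proof (rule proves_Ex_elim[OF _ ExE.prems(1)])
    fix t \<Delta>
    assume \<Delta>: "world \<Delta>" "\<Gamma> \<subseteq> \<Delta>" "proves L \<Delta> (inst t (interp (lift_tm F) (up e) p))"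
    then have "proves L \<Delta> (interp F (case_nat t e) (lift q))"
      using ExE.prems by (intro ExE.IH(2)) (auto intro: proves_weaken[OF _ \<Delta>(2)])
    then show "proves L \<Delta> (interp F e q)" by simp
  qed
next
  case (EqRefl A t)
  then show ?case by (simp add: proves.EqRefl)
next
  case (EqSubst A t u p)
  from EqSubst.IH(1)[OF EqSubst.prems] EqSubst.IH(2)[OF EqSubst.prems] show ?case
    using proves.EqSubst[of L \<Gamma> "subst_tm e t" "subst_tm e u" "interp (lift_tm F) (up e) p"]
    by (simp add: interp_inst)
next
  case (DNE A p)
  from DNE.IH[OF DNE.prems] show ?case by simp (rule proves.DNE[OF DNE.hyps(1)])
qed

lemma interp_All_funpow:
  assumes "world \<Gamma>" "\<And>e. proves L \<Gamma> (interp F e p)"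
  shows "proves L \<Gamma> (interp F e ((All ^^ n) p))"
  using assms by (induction n arbitrary: e) (auto simp: proves_All_iff)

lemma interp_univ_closure:
  "world \<Gamma> \<Longrightarrow> (\<And>e. proves L \<Gamma> (interp F e p)) \<Longrightarrow> proves L \<Gamma> (interp F e (univ_closure p))"
  unfolding univ_closure_def by (rule interp_All_funpow)

section \<open>Stratifying the interpretation\<close>

text \<open>
  The level of a term, read off its leftmost variable, which is enough when \<open>s\<close> gives the term a
  level at all.
\<close>

primrec level :: "(nat \<Rightarrow> nat) \<Rightarrow> tm \<Rightarrow> nat" where
  "level s (Var i) = s i"
| "level s (OPair t u) = level s t"

lemma level_eq: "has_level s t n \<Longrightarrow> level s t = n"
  by (induction t) auto

text \<open>
  The interpretation in which an atom \<open>t \<in> u\<close> uses the parameter \<open>G n\<close> belonging to the level \<open>n\<close>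
  of \<open>u\<close>. The levels of bound variables are not part of a formula, so a choice that stratifies
  the body is made at each quantifier.
\<close>

primrec typed_interp :: "(nat \<Rightarrow> tm) \<Rightarrow> (nat \<Rightarrow> nat) \<Rightarrow> (nat \<Rightarrow> tm) \<Rightarrow> fm \<Rightarrow> fm" where
  "typed_interp G s e Bot = Bot"
| "typed_interp G s e (t \<^bold>= u) = (subst_tm e t \<^bold>= subst_tm e u)"
| "typed_interp G s e (t \<^bold>\<in> u) = mem_via (G (level s u)) (subst_tm e t) (subst_tm e u)"
| "typed_interp G s e (SetP t) = Neg Bot"
| "typed_interp G s e (p \<^bold>\<and> q) = (typed_interp G s e p \<^bold>\<and> typed_interp G s e q)"
| "typed_interp G s e (p \<^bold>\<or> q) = (typed_interp G s e p \<^bold>\<or> typed_interp G s e q)"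
| "typed_interp G s e (p \<^bold>\<longrightarrow> q) = (typed_interp G s e p \<^bold>\<longrightarrow> typed_interp G s e q)"
| "typed_interp G s e (All p) = All (typed_interp (\<lambda>n. lift_tm (G n))
    (case_nat (SOME n. strat (case_nat n s) p) s) (up e) p)"
| "typed_interp G s e (Ex p) = Ex (typed_interp (\<lambda>n. lift_tm (G n))
    (case_nat (SOME n. strat (case_nat n s) p) s) (up e) p)"

text \<open>
  Identifying all the parameters gives back the interpretation through a single \<open>F\<close>, and the levels
  disappear.
\<close>

lemma subst_typed_interp:
  "(\<And>n. subst_tm \<sigma> (G n) = F) \<Longrightarrow>
    subst \<sigma> (typed_interp G s e p) = interp F (\<lambda>i. subst_tm \<sigma> (e i)) p"
  by (induction p arbitrary: \<sigma> G F s e)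
    (auto simp: subst_tm_comp subst_tm_up_comp subst_tm_up_lift_tm)

lemma has_level_lift_tm [simp]: "has_level (case_nat m s) (lift_tm t) n \<longleftrightarrow> has_level s t n"
  by (induction t) auto

lemma has_level_up:
  "(\<And>i. has_level s' (e i) (s i)) \<Longrightarrow> has_level (case_nat m s') (up e i) (case_nat m s i)"
  by (cases i) auto

lemma has_level_subst_tm:
  "has_level s t n \<Longrightarrow> (\<And>i. has_level s' (e i) (s i)) \<Longrightarrow> has_level s' (subst_tm e t) n"
  by (induction t) auto

lemma strat_mem_via:
  assumes "has_level s t n" "has_level s u (Suc n)" "has_level s F (Suc (Suc n))"
  shows "strat s (mem_via F t u)"
proof -
  have "strat (case_nat (Suc n) s) (OPair (lift_tm u) (Var 0) \<^bold>\<in> lift_tm F \<^bold>\<and> lift_tm t \<^bold>\<in> Var 0)"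
    using assms by auto
  then show ?thesis unfolding mem_via_def strat.simps(9) by (rule exI)
qed

text \<open>
  In an atom \<open>t \<in> u\<close> with \<open>u\<close> at level \<open>n\<close>, the value at \<open>u\<close> and the pair that assigns it also
  have level \<open>n\<close>, so the parameter belonging to \<open>n\<close> has level \<open>n + 1\<close>, independently of the atom.
\<close>

lemma strat_typed_interp:
  assumes "strat s p" "\<And>i. has_level s' (e i) (s i)" "\<And>n. has_level s' (G n) (Suc n)"
  shows "strat s' (typed_interp G s e p)"
  using assms
proof (induction p arbitrary: s s' e G)
  case (Eq t u)
  then show ?case using has_level_subst_tm[of s _ _ s' e] by simp blast
next
  case (Mem t u)
  then obtain n where n: "has_level s t n" "has_level s u (n + 1)" by auto
  then have "has_level s' (subst_tm e t) n" "has_level s' (subst_tm e u) (n + 1)"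
    using has_level_subst_tm[of s _ _ s' e] Mem.prems(2) by blast+
  then show ?case using Mem.prems(3)[of "n + 1"] level_eq[OF n(2)]
    by (auto intro: strat_mem_via)
next
  case (All p)
  let ?n = "SOME n. strat (case_nat n s) p"
  have "strat (case_nat ?n s) p" using All.prems(1) by (auto intro: someI)
  then have "strat (case_nat ?n s')
      (typed_interp (\<lambda>n. lift_tm (G n)) (case_nat ?n s) (up e) p)"
    using All.prems by (intro All.IH has_level_up) auto
  then show ?case by auto
next
  case (Ex p)
  let ?n = "SOME n. strat (case_nat n s) p"
  have "strat (case_nat ?n s) p" using Ex.prems(1) by (auto intro: someI)
  then have "strat (case_nat ?n s')
      (typed_interp (\<lambda>n. lift_tm (G n)) (case_nat ?n s) (up e) p)"
    using Ex.prems by (intro Ex.IH has_level_up) auto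
  then show ?case by auto
qed auto


lemma fv_tm_subst_tm: "fv_tm (subst_tm e t) = (\<Union>i\<in>fv_tm t. fv_tm (e i))"
  by (induction t) auto

lemma fv_mem_via [simp]: "fv (mem_via F t u) = fv_tm F \<union> fv_tm t \<union> fv_tm u"
  by (auto simp: mem_via_def)

lemma fv_tm_up: "(\<And>i. k \<notin> fv_tm (e i)) \<Longrightarrow> Suc k \<notin> fv_tm (up e i)"
  by (cases i) auto

lemma fv_typed_interp:
  "(\<And>i. k \<notin> fv_tm (e i)) \<Longrightarrow> (\<And>n. k \<notin> fv_tm (G n)) \<Longrightarrow> k \<notin> fv (typed_interp G s e p)"
proof (induction p arbitrary: k e G s)
  case (All p)
  then have "Suc k \<notin> fv (typed_interp (\<lambda>n. lift_tm (G n)) s' (up e) p)" for s'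
    by (intro All.IH fv_tm_up) auto
  then show ?case by simp
next
  case (Ex p)
  then have "Suc k \<notin> fv (typed_interp (\<lambda>n. lift_tm (G n)) s' (up e) p)" for s'
    by (intro Ex.IH fv_tm_up) auto
  then show ?case by simp
qed (auto simp: fv_tm_subst_tm)

section \<open>From the bijection to NF\<close>

text \<open>
  \<open>F\<close> is provably a bijection from \<open>V\<close> to \<open>P(V)\<close>, so that every object codes a set and every set has
  exactly one code. Larger worlds are mentioned so that the assumptions can be used under hypotheses
  added later.
\<close>

locale set_coding = NFU_world +
  fixes F :: tm
  assumes total: "\<And>t \<Delta>. world \<Delta> \<Longrightarrow> \<Gamma> \<subseteq> \<Delta> \<Longrightarrow>
      proves L \<Delta> (Ex (OPair (lift_tm t) (Var 0) \<^bold>\<in> lift_tm F))"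
    and set_valued: "\<And>t u \<Delta>. world \<Delta> \<Longrightarrow> \<Gamma> \<subseteq> \<Delta> \<Longrightarrow>
      proves L \<Delta> (OPair t u \<^bold>\<in> F) \<Longrightarrow> proves L \<Delta> (SetP u)"
    and functional: "\<And>t u v \<Delta>. world \<Delta> \<Longrightarrow> \<Gamma> \<subseteq> \<Delta> \<Longrightarrow>
      proves L \<Delta> (OPair t u \<^bold>\<in> F) \<Longrightarrow> proves L \<Delta> (OPair t v \<^bold>\<in> F) \<Longrightarrow> proves L \<Delta> (u \<^bold>= v)"
    and injective: "\<And>t u v \<Delta>. world \<Delta> \<Longrightarrow> \<Gamma> \<subseteq> \<Delta> \<Longrightarrow>
      proves L \<Delta> (OPair t v \<^bold>\<in> F) \<Longrightarrow> proves L \<Delta> (OPair u v \<^bold>\<in> F) \<Longrightarrow> proves L \<Delta> (t \<^bold>= u)"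
    and onto: "\<And>u \<Delta>. world \<Delta> \<Longrightarrow> \<Gamma> \<subseteq> \<Delta> \<Longrightarrow> proves L \<Delta> (SetP u) \<Longrightarrow>
      proves L \<Delta> (Ex (OPair (Var 0) (lift_tm u) \<^bold>\<in> lift_tm F))"
begin

lemma mono: "world \<Delta> \<Longrightarrow> \<Gamma> \<subseteq> \<Delta> \<Longrightarrow> set_coding L \<Delta> F"
  using total set_valued functional injective onto axioms world
  by (unfold_locales) (meson order_trans)+

lemma obtain_value:
  assumes "\<And>u \<Delta>. set_coding L \<Delta> F \<Longrightarrow> \<Gamma> \<subseteq> \<Delta> \<Longrightarrow> proves L \<Delta> (OPair t u \<^bold>\<in> F) \<Longrightarrow> proves L \<Delta> q"
  shows "proves L \<Gamma> q"
proof (rule proves_Ex_elim[OF total[of \<Gamma> t] world])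
  fix u \<Delta>
  assume "world \<Delta>" "\<Gamma> \<subseteq> \<Delta>"
    and "proves L \<Delta> (inst u (OPair (lift_tm t) (Var 0) \<^bold>\<in> lift_tm F))"
  then show "proves L \<Delta> q" by (intro assms[of \<Delta> u] mono) auto
qed (use world in auto)

lemma mem_via_iff:
  assumes "proves L \<Gamma> (OPair u a \<^bold>\<in> F)"
  shows "proves L \<Gamma> (mem_via F t u) \<longleftrightarrow> proves L \<Gamma> (t \<^bold>\<in> a)"
proof
  assume "proves L \<Gamma> (t \<^bold>\<in> a)"
  with assms show "proves L \<Gamma> (mem_via F t u)"
    unfolding mem_via_def by (intro proves.ExI[where t = a]) (simp add: proves.AndI)
next
  assume "proves L \<Gamma> (mem_via F t u)"
  then show "proves L \<Gamma> (t \<^bold>\<in> a)"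
    unfolding mem_via_def
  proof (rule proves_Ex_elim[OF _ world])
    fix b \<Delta>
    assume \<Delta>: "world \<Delta>" "\<Gamma> \<subseteq> \<Delta>"
      and "proves L \<Delta> (inst b (OPair (lift_tm u) (Var 0) \<^bold>\<in> lift_tm F \<^bold>\<and> lift_tm t \<^bold>\<in> Var 0))"
    then have b: "proves L \<Delta> (OPair u b \<^bold>\<in> F)" "proves L \<Delta> (t \<^bold>\<in> b)"
      by (simp_all add: proves_And_iff)
    have "proves L \<Delta> (b \<^bold>= a)"
      using functional[OF \<Delta> b(1)] proves_weaken[OF assms \<Delta>(2)] by blast
    then show "proves L \<Delta> (t \<^bold>\<in> a)" using b(2) by (rule proves_Mem_cong[OF proves.EqRefl])
  qed
qed

text \<open>
  Objects with the same interpreted members have values under \<open>F\<close> with the same members; these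
  values are sets, hence equal, and \<open>F\<close> is injective.
\<close>

lemma mem_via_extensional:
  assumes same: "\<And>x \<Delta>. world \<Delta> \<Longrightarrow> \<Gamma> \<subseteq> \<Delta> \<Longrightarrow>
    proves L \<Delta> (mem_via F x t) \<longleftrightarrow> proves L \<Delta> (mem_via F x u)"
  shows "proves L \<Gamma> (t \<^bold>= u)"
proof (rule obtain_value[of t])
  fix a \<Delta>
  assume \<Delta>: "set_coding L \<Delta> F" "\<Gamma> \<subseteq> \<Delta>" and a: "proves L \<Delta> (OPair t a \<^bold>\<in> F)"
  show "proves L \<Delta> (t \<^bold>= u)"
  proof (rule set_coding.obtain_value[OF \<Delta>(1), of u])
    fix b \<Theta>
    assume \<Theta>: "set_coding L \<Theta> F" "\<Delta> \<subseteq> \<Theta>" and b: "proves L \<Theta> (OPair u b \<^bold>\<in> F)"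
    interpret \<Theta>: set_coding L \<Theta> F by fact
    have a': "proves L \<Theta> (OPair t a \<^bold>\<in> F)" using a \<Theta>(2) by (rule proves_weaken)
    have "proves L \<Theta> (a \<^bold>= b)"
    proof (rule \<Theta>.extensional)
      show "proves L \<Theta> (SetP a)" "proves L \<Theta> (SetP b)"
        using \<Theta>.set_valued[OF \<Theta>.world order_refl] a' b by blast+
      fix x \<Xi>
      assume \<Xi>: "world \<Xi>" "\<Theta> \<subseteq> \<Xi>"
      interpret \<Xi>: set_coding L \<Xi> F using \<Xi> by (rule \<Theta>.mono)
      have "proves L \<Xi> (x \<^bold>\<in> a) \<longleftrightarrow> proves L \<Xi> (mem_via F x t)"
        using \<Xi>.mem_via_iff[OF proves_weaken[OF a' \<Xi>(2)]] by simp
      also have "\<dots> \<longleftrightarrow> proves L \<Xi> (mem_via F x u)"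
        using \<Xi> \<Delta>(2) \<Theta>(2) by (intro same) auto
      also have "\<dots> \<longleftrightarrow> proves L \<Xi> (x \<^bold>\<in> b)"
        by (rule \<Xi>.mem_via_iff[OF proves_weaken[OF b \<Xi>(2)]])
      finally show "proves L \<Xi> (x \<^bold>\<in> a) \<longleftrightarrow> proves L \<Xi> (x \<^bold>\<in> b)" .
    qed
    then have "proves L \<Theta> (OPair t a \<^bold>= OPair t b)" by (intro proves_OPair_cong proves.EqRefl)
    then have "proves L \<Theta> (OPair t b \<^bold>\<in> F)"
      using proves.EqRefl a' by (rule proves_Mem_cong)
    then show "proves L \<Theta> (t \<^bold>= u)"
      using b by (rule \<Theta>.injective[OF \<Theta>.world order_refl])
  qed
qed

text \<open>
  The even variables carry the original ones, and \<open>Var (2 * n + 3)\<close> is the parameter belonging to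
  level \<open>n\<close>. This leaves out \<open>Var 1\<close>, which comprehension reserves for the set being defined, and
  puts the element variable \<open>Var 0\<close> where it was.
\<close>

lemma interp_comprehension:
  assumes "stratified \<phi>" "1 \<notin> fv \<phi>"
  shows "proves L \<Gamma> (interp F e (comprehension \<phi>))"
proof -
  obtain s where s: "strat s \<phi>" using assms(1) by (auto simp: stratified_def)
  define \<psi> where "\<psi> = typed_interp (\<lambda>n. Var (2 * n + 3)) s (\<lambda>i. Var (2 * i)) \<phi>"
  \<comment> \<open>Under two binders: the odd variables become \<open>F\<close>, and \<open>2 * i\<close> becomes \<open>e (i - 2)\<close>; the value at \<open>i = 1\<close> is a dummy.\<close>
  define e' where "e' = (\<lambda>k. if even k then case_nat F e (k div 2) else F)"
  have "strat (\<lambda>k. if even k then s (k div 2) else Suc ((k - 3) div 2)) \<psi>"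
    unfolding \<psi>_def by (rule strat_typed_interp[OF s]) auto
  then have "stratified \<psi>" by (auto simp: stratified_def)
  moreover have "1 \<notin> fv \<psi>" unfolding \<psi>_def by (rule fv_typed_interp) auto
  ultimately show ?thesis
  proof (rule comprehensionE[where e = e'])
    fix a \<Delta>
    assume \<Delta>: "NFU_world \<Delta>" "\<Gamma> \<subseteq> \<Delta>" "proves L \<Delta> (SetP a)"
      and a: "\<And>t \<Theta>. world \<Theta> \<Longrightarrow> \<Delta> \<subseteq> \<Theta> \<Longrightarrow>
        proves L \<Theta> (t \<^bold>\<in> a) \<longleftrightarrow> proves L \<Theta> (subst (case_nat t (case_nat a e')) \<psi>)"
    \<comment> \<open>Since \<open>Var 1\<close> is not free in \<open>\<phi>\<close>, the set \<open>a\<close> may be replaced there by its code \<open>y\<close>.\<close>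
    have \<psi>: "subst (case_nat t (case_nat a e')) \<psi> = interp F (case_nat t (case_nat y e)) \<phi>" for t y
    proof -
      have "subst (case_nat t (case_nat a e')) \<psi> =
          interp F (\<lambda>i. subst_tm (case_nat t (case_nat a e')) (Var (2 * i))) \<phi>"
        unfolding \<psi>_def by (rule subst_typed_interp) (simp add: e'_def numeral_3_eq_3)
      also have "\<dots> = interp F (case_nat t (case_nat y e)) \<phi>"
      proof (rule interp_cong)
        fix i assume "i \<in> fv \<phi>"
        with assms(2) have "i \<noteq> 1" by auto
        then show "subst_tm (case_nat t (case_nat a e')) (Var (2 * i)) = case_nat t (case_nat y e) i"
          by (auto simp: e'_def split: nat.split)
      qed
      finally show ?thesis .
    qed
    have w: "world \<Delta>" using \<Delta>(1) by (simp add: NFU_world_def)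
    show "proves L \<Delta> (interp F e (comprehension \<phi>))"
    proof (rule proves_Ex_elim[OF onto[OF w \<Delta>(2,3)] w])
      fix y \<Theta>
      assume \<Theta>: "world \<Theta>" "\<Delta> \<subseteq> \<Theta>"
        and "proves L \<Theta> (inst y (OPair (Var 0) (lift_tm a) \<^bold>\<in> lift_tm F))"
      then have y: "proves L \<Theta> (OPair y a \<^bold>\<in> F)" by simp
      have "proves L \<Xi> (mem_via F t y) \<longleftrightarrow> proves L \<Xi> (interp F (case_nat t (case_nat y e)) \<phi>)"
        if \<Xi>: "world \<Xi>" "\<Theta> \<subseteq> \<Xi>" for t \<Xi>
      proof -
        interpret \<Xi>: set_coding L \<Xi> F using \<Xi> \<Delta>(2) \<Theta>(2) by (intro mono) auto
        show ?thesis
          using \<Xi>.mem_via_iff[OF proves_weaken[OF y \<Xi>(2)], of t] a[OF \<Xi>(1), of t] \<Theta>(2) \<Xi>(2)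
          by (auto simp: \<psi>[of t y])
      qed
      then have "proves L \<Theta> (interp F (case_nat y e)
          (SetP (Var 0) \<^bold>\<and> All (Var 0 \<^bold>\<in> Var 1 \<^bold>\<longleftrightarrow> \<phi>)))"
        using \<Theta>(1) by (simp add: interp_forces_All interp_forces_And interp_forces_Imp
            proves.ImpI proves.Assm del: interp.simps(5,7,8))
      then show "proves L \<Theta> (interp F e (comprehension \<phi>))"
        unfolding comprehension_def interp.simps(9)
        by (intro proves.ExI[where t = y]) (simp only: inst_interp)
    qed
  qed
qed

lemma interp_same_elements:
  assumes "world \<Delta>" "\<Gamma> \<subseteq> \<Delta>"
    and same: "proves L \<Delta> (interp F e (All (Var 0 \<^bold>\<in> Var 2 \<^bold>\<longleftrightarrow> Var 0 \<^bold>\<in> Var 1)))"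
  shows "proves L \<Delta> (e (Suc 0) \<^bold>= e 0)"
proof -
  interpret \<Delta>: set_coding L \<Delta> F using assms(1,2) by (rule mono)
  show ?thesis
  proof (rule \<Delta>.mem_via_extensional)
    fix x \<Theta>
    assume \<Theta>: "world \<Theta>" "\<Delta> \<subseteq> \<Theta>"
    have "proves L \<Delta> (interp F (case_nat x e) (Var 0 \<^bold>\<in> Var 2 \<^bold>\<longleftrightarrow> Var 0 \<^bold>\<in> Var 1))"
      using same unfolding interp_forces_All[OF assms(1)] by blast
    then have "proves L \<Delta> (mem_via F x (e (Suc 0)) \<^bold>\<longleftrightarrow> mem_via F x (e 0))"
      by (simp add: eval_nat_numeral)
    then show "proves L \<Theta> (mem_via F x (e (Suc 0))) \<longleftrightarrow> proves L \<Theta> (mem_via F x (e 0))"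
      unfolding proves_And_iff proves_Imp_iff[OF assms(1)] using \<Theta> by blast
  qed
qed

text \<open>
  Pairing is interpreted by itself, and sethood is trivial, so only extensionality and comprehension
  depend on \<open>F\<close>.
\<close>

lemma interp_NF_axioms:
  assumes "p \<in> insert (All (SetP (Var 0))) NFU_axioms"
  shows "proves L \<Gamma> (interp F e p)"
proof -
  have "proves L \<Gamma> (interp F e extensionality)" for e
    unfolding extensionality_def interp_forces_Imp[OF world]
  proof (intro allI impI)
    fix \<Delta>
    assume \<Delta>: "world \<Delta>" "\<Gamma> \<subseteq> \<Delta>" and "proves L \<Delta> (interp F e (SetP (Var 1) \<^bold>\<and> SetP (Var 0)
        \<^bold>\<and> All (Var 0 \<^bold>\<in> Var 2 \<^bold>\<longleftrightarrow> Var 0 \<^bold>\<in> Var 1)))"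
    then have "proves L \<Delta> (e (Suc 0) \<^bold>= e 0)"
      unfolding interp_forces_And by (intro interp_same_elements) blast+
    then show "proves L \<Delta> (interp F e (Var 1 \<^bold>= Var 0))" by simp
  qed
  moreover have "proves L \<Gamma> (interp F e pair_injective)" for e
    using axiom_instance[of pair_injective e] by (simp add: pair_injective_def)
  moreover have "proves L \<Gamma> (interp F e elements_only_in_sets)" for e
    unfolding elements_only_in_sets_def using world by (simp add: proves_Imp_iff)
  moreover have "proves L \<Gamma> (interp F e (All (SetP (Var 0))))"
    unfolding interp_forces_All[OF world] using world by (simp add: proves_Imp_iff)
  ultimately show ?thesis
    using assms interp_comprehension
    by (auto simp: NFU_axioms_def intro!: interp_univ_closure[OF world])
qed

lemma interp_NF_Bot:
  assumes "proves L (insert (All (SetP (Var 0))) NFU_axioms) Bot"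
  shows "proves L \<Gamma> Bot"
  using interp_sound[OF assms world interp_NF_axioms, of Var] by simp

end

text \<open>
  A pair in \<open>F\<close> is only known to be equal to some pair in \<open>V \<times> P(V)\<close>; injectivity of pairing
  transfers sethood to its second component.
\<close>

lemma proves_range_set:
  assumes "NFU_world \<Gamma>"
    and range: "\<And>y \<Delta>. world \<Delta> \<Longrightarrow> \<Gamma> \<subseteq> \<Delta> \<Longrightarrow> proves L \<Delta> (y \<^bold>\<in> p) \<Longrightarrow> proves L \<Delta> (SetP y)"
    and ex: "proves L \<Gamma> (Ex (Ex (Var 1 \<^bold>\<in> lift_tm (lift_tm v) \<^bold>\<and> Var 0 \<^bold>\<in> lift_tm (lift_tm p)
        \<^bold>\<and> lift_tm (lift_tm (OPair t u)) \<^bold>= OPair (Var 1) (Var 0))))"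
  shows "proves L \<Gamma> (SetP u)"
proof (rule proves_Ex_elim[OF ex])
  show "world \<Gamma>" using assms(1) by (simp add: NFU_world_def)
  fix x \<Delta>
  assume \<Delta>: "world \<Delta>" "\<Gamma> \<subseteq> \<Delta>"
    and "proves L \<Delta> (inst x (Ex (Var 1 \<^bold>\<in> lift_tm (lift_tm v) \<^bold>\<and> Var 0 \<^bold>\<in> lift_tm (lift_tm p)
        \<^bold>\<and> lift_tm (lift_tm (OPair t u)) \<^bold>= OPair (Var 1) (Var 0))))"
  then have "proves L \<Delta> (Ex (lift_tm x \<^bold>\<in> lift_tm v \<^bold>\<and> Var 0 \<^bold>\<in> lift_tm p
      \<^bold>\<and> lift_tm (OPair t u) \<^bold>= OPair (lift_tm x) (Var 0)))"
    by (simp add: inst_def subst_tm_up_lift_tm)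
  then show "proves L \<Delta> (SetP u)"
  proof (rule proves_Ex_elim[OF _ \<Delta>(1)])
    fix y \<Theta>
    assume \<Theta>: "world \<Theta>" "\<Delta> \<subseteq> \<Theta>"
      and "proves L \<Theta> (inst y (lift_tm x \<^bold>\<in> lift_tm v \<^bold>\<and> Var 0 \<^bold>\<in> lift_tm p
        \<^bold>\<and> lift_tm (OPair t u) \<^bold>= OPair (lift_tm x) (Var 0)))"
    then have y: "proves L \<Theta> (y \<^bold>\<in> p)" and eq: "proves L \<Theta> (OPair t u \<^bold>= OPair x y)"
      by (simp_all add: proves_And_iff)
    interpret \<Theta>: NFU_world L \<Theta>
      using NFU_world_mono[OF assms(1) \<Theta>(1)] \<Delta>(2) \<Theta>(2) by blast
    have "proves L \<Theta> (SetP y)" using \<Theta> \<Delta>(2) y by (intro range) auto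
    then show "proves L \<Theta> (SetP u)"
      using \<Theta>.pair_injD(2)[OF eq] by (blast intro: proves_SetP_cong proves_Eq_sym)
  qed
qed

text \<open>
  The sentence yields a bijection only after three existential eliminations, so it is used in this
  form: what follows from every coding, follows.
\<close>

lemma card_V_eq_card_PV_set_coding:
  assumes "NFU_world \<Gamma>" "proves L \<Gamma> card_V_eq_card_PV"
    and cont: "\<And>F \<Delta>. set_coding L \<Delta> F \<Longrightarrow> proves L \<Delta> q"
  shows "proves L \<Gamma> q"
proof -
  let ?B = "is_comprehension 1 (Var 0 \<^bold>= Var 0) \<^bold>\<and> is_comprehension 0 (SetP (Var 0))
      \<^bold>\<and> Ex (bijection 0 2 1)"
  have w: "world \<Gamma>" using assms(1) by (simp add: NFU_world_def)
  have "proves L \<Gamma> (subst Var (Ex (Ex ?B)))"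
    using assms(2) by (simp only: card_V_eq_card_PV_def subst_Var)
  then show ?thesis
  proof (rule forces_ExE[OF _ w])
    fix v \<Delta>
    assume \<Delta>: "world \<Delta>" "\<Gamma> \<subseteq> \<Delta>" and Ex_B: "proves L \<Delta> (subst (case_nat v Var) (Ex ?B))"
    from Ex_B show "proves L \<Delta> q"
    proof (rule forces_ExE[OF _ \<Delta>(1)])
      fix p \<Theta>
      assume \<Theta>: "world \<Theta>" "\<Delta> \<subseteq> \<Theta>"
        and B: "proves L \<Theta> (subst (case_nat p (case_nat v Var)) ?B)"
      from B have v: "\<And>t \<Xi>. world \<Xi> \<Longrightarrow> \<Theta> \<subseteq> \<Xi> \<Longrightarrow> proves L \<Xi> (t \<^bold>\<in> v)"
        and p: "\<And>t \<Xi>. world \<Xi> \<Longrightarrow> \<Theta> \<subseteq> \<Xi> \<Longrightarrow> proves L \<Xi> (t \<^bold>\<in> p) \<longleftrightarrow> proves L \<Xi> (SetP t)"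
        unfolding forces_And proves_is_comprehension_iff[OF \<Theta>(1)] by (simp_all add: proves.EqRefl)
      from B have "proves L \<Theta> (subst (case_nat p (case_nat v Var)) (Ex (bijection 0 2 1)))"
        unfolding forces_And by simp
      then show "proves L \<Theta> q"
      proof (rule forces_ExE[OF _ \<Theta>(1)])
        fix F \<Xi>
        assume \<Xi>: "world \<Xi>" "\<Theta> \<subseteq> \<Xi>"
          and "proves L \<Xi> (subst (case_nat F (case_nat p (case_nat v Var))) (bijection 0 2 1))"
        note bij = this(3)[unfolded proves_bijection_iff[OF \<Xi>(1)]]
        have NFU: "NFU_world \<Omega>" if "world \<Omega>" "\<Xi> \<subseteq> \<Omega>" for \<Omega>
          using NFU_world_mono[OF assms(1) that(1)] \<Delta>(2) \<Theta>(2) \<Xi>(2) that(2) by blast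
        interpret NFU_world L \<Xi> using NFU[OF \<Xi>(1)] by simp
        have "set_coding L \<Xi> F"
        proof
          fix t \<Omega> assume \<Omega>: "world \<Omega>" "\<Xi> \<subseteq> \<Omega>"
          then have "proves L \<Omega> (t \<^bold>\<in> v)" using \<Xi>(2) by (intro v) auto
          then show "proves L \<Omega> (Ex (OPair (lift_tm t) (Var 0) \<^bold>\<in> lift_tm F))"
            using bij \<Omega> by simp
        next
          fix t u \<Omega>
          assume \<Omega>: "world \<Omega>" "\<Xi> \<subseteq> \<Omega>" and "proves L \<Omega> (OPair t u \<^bold>\<in> F)"
          then have "proves L \<Omega> (Ex (Ex (Var 1 \<^bold>\<in> lift_tm (lift_tm v) \<^bold>\<and>
              Var 0 \<^bold>\<in> lift_tm (lift_tm p) \<^bold>\<and>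
              lift_tm (lift_tm (OPair t u)) \<^bold>= OPair (Var 1) (Var 0))))"
            using bij by (simp del: lift_tm_simps)
          then show "proves L \<Omega> (SetP u)"
          proof (rule proves_range_set[OF NFU[OF \<Omega>], rotated])
            fix y \<Pi> assume "world \<Pi>" "\<Omega> \<subseteq> \<Pi>" "proves L \<Pi> (y \<^bold>\<in> p)"
            then show "proves L \<Pi> (SetP y)" using p[of \<Pi> y] \<Omega>(2) \<Xi>(2) by blast
          qed
        next
          fix t u r \<Omega>
          assume "world \<Omega>" "\<Xi> \<subseteq> \<Omega>" "proves L \<Omega> (OPair t u \<^bold>\<in> F)" "proves L \<Omega> (OPair t r \<^bold>\<in> F)"
          then show "proves L \<Omega> (u \<^bold>= r)" using bij by simp
        next
          fix t u r \<Omega>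
          assume "world \<Omega>" "\<Xi> \<subseteq> \<Omega>" "proves L \<Omega> (OPair t r \<^bold>\<in> F)" "proves L \<Omega> (OPair u r \<^bold>\<in> F)"
          then show "proves L \<Omega> (t \<^bold>= u)" using bij by simp
        next
          fix u \<Omega> assume \<Omega>: "world \<Omega>" "\<Xi> \<subseteq> \<Omega>" "proves L \<Omega> (SetP u)"
          then have "proves L \<Omega> (u \<^bold>\<in> p)" using p[of \<Omega> u] \<Xi>(2) by blast
          then show "proves L \<Omega> (Ex (OPair (Var 0) (lift_tm u) \<^bold>\<in> lift_tm F))"
            using bij \<Omega> by simp
        qed
        then show "proves L \<Xi> q" by (rule cont)
      qed
    qed
  qed
qed

theorem equiconsistent_NF_card:
  "equiconsistent (extend (L, NFU_axioms) (All (SetP (Var 0))))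
    (extend (L, NFU_axioms) card_V_eq_card_PV)"
proof -
  let ?NF = "insert (All (SetP (Var 0))) NFU_axioms"
  let ?NFU = "insert card_V_eq_card_PV NFU_axioms"
  have NFU_world: "NFU_world (insert p NFU_axioms)" for p
    using world_NFU_axioms by (auto simp: NFU_world_def)
  have "proves L ?NF Bot \<longleftrightarrow> proves L ?NFU Bot"
  proof
    assume NF: "proves L ?NF Bot"
    show "proves L ?NFU Bot"
      using NFU_world proves.Assm[OF insertI1]
    proof (rule card_V_eq_card_PV_set_coding)
      show "proves L \<Delta> Bot" if "set_coding L \<Delta> F" for \<Delta> F
        using that NF by (rule set_coding.interp_NF_Bot)
    qed
  next
    assume NFU: "proves L ?NFU Bot"
    have "proves L ?NF card_V_eq_card_PV"
      by (intro NF_card_V_eq_card_PV NFU_world proves.Assm insertI1)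
    moreover have "proves L (insert card_V_eq_card_PV ?NF) Bot"
      using NFU by (rule proves_weaken) auto
    ultimately show "proves L ?NF Bot" by (blast intro: proves_cut)
  qed
  then show ?thesis by (simp add: equiconsistent_def consistent_def extend_def)
qed

theorem corollary7p2p22:
  shows "equiconsistent INF_Set (extend INFU_Set card_V_eq_card_PV)
    \<and> equiconsistent NF_Set (extend NFU_Set card_V_eq_card_PV)"
  using equiconsistent_NF_card by (simp add: INF_Set_def NF_Set_def INFU_Set_def NFU_Set_def)

end
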